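(* Suppose the adjacency matrix $A$ on $n$ nodes is generated from the $K$-block stochastic block model with true parameter $\theta^*\in\Theta_K$, as described in the context. Let $(N_{K'})_{K'\ge1}$ be a strictly increasing sequence of real numbers (not depending on $n$), let $B_n>0$, and define $$\beta(K')=\sup_{\theta\in\Theta_{K'}}\log g(A;\theta)-N_{K'}B_n .$$ (i) For fixed $K'<K$, if $B_n=o(n^2\rho_n)$, then $P_{\theta^*}(\beta(K')<\beta(K))\to1$ as $n\to\infty$. (ii) For fixed $K'>K$, if $B_nn^{-3/2}\rho_n^{-1/2}\to\infty$, then $P_{\theta^*}(\beta(K')<\beta(K))\to1$ as $n\to\infty$.
   Context: Model. $[K]=\{1,\dots,K\}$, with $K$ fixed as $n\to\infty$. For $K'\ge1$, $\Theta_{K'}$ is the set of $\theta=(\pi,H)$ with $\pi\in(0,1)^{K'}$, $\sum_a\pi_a=1$ (for $K'=1$, $\pi=1$), and $H\in(0,1)^{K'\times K'}$ symmetric. Under $\theta^*=(\pi^*,H^* )\in\Theta_K$, the latent labels $Z=(Z_1,\dots,Z_n)\in[K]^n$ are i.i.d. with $P(Z_i=a)=\pi_a^*$; given $Z$, $A$ is a symmetric $0/1$ matrix with zero diagonal whose entries $A_{i,j}$, $i<j$, are independent Bernoulli$(H^*_{Z_i,Z_j})$. $P_{\theta^*}$ denotes the resulting probability. Write $H^*=\rho_nS^*$, where $\pi^*$ and the symmetric matrix $S^*$ with positive entries do not depend on $n$, and $H^*$ has no two identical columns. The degree density $\rho_n$ satisfies either $\rho_n=\Omega(1)$, or $\rho_n\to0$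 with $n\rho_n/\log n\to\infty$. Likelihood. For $z\in[K']^n$ let $n_a(z)=\sum_i\mathbf 1(z_i=a)$, $n_{a,b}(z)=\sum_i\sum_{j\ne i}\mathbf 1(z_i=a,z_j=b)$, $O_{a,b}(z)=\sum_i\sum_{j\ne i}\mathbf 1(z_i=a,z_j=b)A_{i,j}$. For $\theta\in\Theta_{K'}$, $$f(z,A;\theta)=\Big(\prod_{a=1}^{K'}\pi_a^{n_a(z)}\Big)\Big(\prod_{a,b=1}^{K'}H_{a,b}^{O_{a,b}(z)}(1-H_{a,b})^{n_{a,b}(z)-O_{a,b}(z)}\Big)^{1/2},\qquad g(A;\theta)=\sum_{z\in[K']^n}f(z,A;\theta).$$ *)

theory Defs
  imports "HOL-Probability.Probability" "HOL-Library.Landau_Symbols"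
begin

text \<open>
  Nodes are \<open>{1..n}\<close> and communities \<open>{1..K}\<close>. A parameter is a pair \<open>(p, H)\<close> of a probability
  vector and a connectivity matrix, both represented as functions on \<open>nat\<close>; values outside
  \<open>{1..K}\<close> are unconstrained and never used.
\<close>

type_synonym param = "(nat \<Rightarrow> real) \<times> (nat \<Rightarrow> nat \<Rightarrow> real)"

type_synonym adj = "nat \<Rightarrow> nat \<Rightarrow> bool"

definition Theta :: "nat \<Rightarrow> param set" where
  "Theta K = {(p, H).
     (if K = 1 then p 1 = 1
      else (\<forall>a\<in>{1..K}. 0 < p a \<and> p a < 1) \<and> (\<Sum>a\<in>{1..K}. p a) = 1) \<and>
     (\<forall>a\<in>{1..K}. \<forall>b\<in>{1..K}. 0 < H a b \<and> H a b < 1 \<and> H a b = H b a)}"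

definition no_identical_columns :: "nat \<Rightarrow> (nat \<Rightarrow> nat \<Rightarrow> real) \<Rightarrow> bool" where
  "no_identical_columns K H \<longleftrightarrow>
     (\<forall>a\<in>{1..K}. \<forall>b\<in>{1..K}. a \<noteq> b \<longrightarrow> (\<exists>c\<in>{1..K}. H c a \<noteq> H c b))"

definition label_pmf :: "nat \<Rightarrow> (nat \<Rightarrow> real) \<Rightarrow> nat pmf" where
  "label_pmf K p = embed_pmf (\<lambda>a. if a \<in> {1..K} then p a else 0)"

text \<open>
  The edge indicators are drawn for \<open>i < j\<close> and extended symmetrically. The default value \<open>False\<close>
  of the product makes the diagonal, and everything outside the node set, zero.
\<close>

definition graph_pmf :: "nat \<Rightarrow> (nat \<Rightarrow> nat \<Rightarrow> real) \<Rightarrow> (nat \<Rightarrow> nat) \<Rightarrow> adj pmf" where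
  "graph_pmf n H z =
     map_pmf (\<lambda>E i j. E (min i j, max i j))
       (Pi_pmf {(i, j). i \<in> {1..n} \<and> j \<in> {1..n} \<and> i < j} False
         (\<lambda>(i, j). bernoulli_pmf (H (z i) (z j))))"

definition sbm :: "nat \<Rightarrow> nat \<Rightarrow> param \<Rightarrow> ((nat \<Rightarrow> nat) \<times> adj) pmf" where
  "sbm n K \<theta> =
     bind_pmf (Pi_pmf {1..n} undefined (\<lambda>_. label_pmf K (fst \<theta>)))
       (\<lambda>Z. map_pmf (\<lambda>A. (Z, A)) (graph_pmf n (snd \<theta>) Z))"

definition block_size :: "nat \<Rightarrow> (nat \<Rightarrow> nat) \<Rightarrow> nat \<Rightarrow> nat" where
  "block_size n z a = (\<Sum>i\<in>{1..n}. of_bool (z i = a))"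

definition block_pairs :: "nat \<Rightarrow> (nat \<Rightarrow> nat) \<Rightarrow> nat \<Rightarrow> nat \<Rightarrow> nat" where
  "block_pairs n z a b = (\<Sum>i\<in>{1..n}. \<Sum>j\<in>{1..n} - {i}. of_bool (z i = a \<and> z j = b))"

definition block_edges :: "nat \<Rightarrow> adj \<Rightarrow> (nat \<Rightarrow> nat) \<Rightarrow> nat \<Rightarrow> nat \<Rightarrow> nat" where
  "block_edges n A z a b =
     (\<Sum>i\<in>{1..n}. \<Sum>j\<in>{1..n} - {i}. of_bool (z i = a \<and> z j = b) * of_bool (A i j))"

text \<open>The subtraction on \<open>nat\<close> below is exact, as \<open>block_edges n A z a b \<le> block_pairs n z a b\<close>.\<close>

definition complete_lik :: "nat \<Rightarrow> nat \<Rightarrow> (nat \<Rightarrow> nat) \<Rightarrow> adj \<Rightarrow> param \<Rightarrow> real" where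
  "complete_lik n K z A \<theta> =
     (\<Prod>a\<in>{1..K}. fst \<theta> a ^ block_size n z a) *
     sqrt (\<Prod>a\<in>{1..K}. \<Prod>b\<in>{1..K}.
       snd \<theta> a b ^ block_edges n A z a b *
       (1 - snd \<theta> a b) ^ (block_pairs n z a b - block_edges n A z a b))"

definition marginal_lik :: "nat \<Rightarrow> nat \<Rightarrow> adj \<Rightarrow> param \<Rightarrow> real" where
  "marginal_lik n K A \<theta> = (\<Sum>z\<in>{1..n} \<rightarrow>\<^sub>E {1..K}. complete_lik n K z A \<theta>)"

text \<open>
  For \<open>K \<ge> 1\<close> the supremum is over a nonempty set, and it is finite: every summand of the marginal
  likelihood lies in \<open>{0<..1}\<close>, so its logarithm is at most \<open>n * ln K\<close>.
\<close>

definition penalized_lik :: "(nat \<Rightarrow> real) \<Rightarrow> real \<Rightarrow> nat \<Rightarrow> adj \<Rightarrow> nat \<Rightarrow> real" where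
  "penalized_lik N b n A K = (SUP \<theta>\<in>Theta K. ln (marginal_lik n K A \<theta>)) - N K * b"

end

theory Submission
  imports Defs
begin

text \<open>
  Write \<open>L K'\<close> for the maximal log-likelihood over \<open>K'\<close>-block models (\<open>log_lik\<close> below) and \<open>e\<close> for
  the conditional probability of the graph \<open>A\<close> given the true labels \<open>Z\<close> and the true connectivity
  matrix \<open>H\<close>. Everything is measured against \<open>ln e\<close>.

  From below, \<open>L K \<ge> ln e - O(n)\<close>: insert the true parameter and keep only the summand of the true
  labeling in the marginal likelihood (\<open>log_lik_ge\<close>).

  From above, the marginal likelihood of a \<open>K'\<close>-block model is a sum over \<open>K' ^ n\<close> labelings \<open>w\<close>.
  For fixed \<open>w\<close> the edge part of the likelihood sees the graph only through the block edge counts, so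
  it is dominated by its value at one of at most \<open>(n\<^sup>2 + 1) ^ K'\<^sup>2\<close> matrices \<open>Q\<close>, namely the blockwise
  maximum likelihood estimates (\<open>edge_lik_le_mle\<close>). For a fixed pair \<open>(w, Q)\<close> the expectation of the
  square root of the likelihood ratio is a product of Bernoulli Hellinger affinities, hence at most
  \<open>exp (- D / 2)\<close> when \<open>D\<close> bounds the sum of \<open>(sqrt H - sqrt Q)\<^sup>2\<close> over all pairs of nodes from below
  (\<open>graph_affinity\<close>). Markov's inequality and a union bound over all \<open>(w, Q)\<close> give
  (\<open>prob_log_lik_exceeds_le\<close>)
    \<open>P (L K' \<ge> ln e + t) \<le> K' ^ n * (n\<^sup>2 + 1) ^ K'\<^sup>2 * exp (- (t + D) / 2)\<close>.

  Too many blocks: take \<open>D = 0\<close> and \<open>t\<close> a large multiple of \<open>n\<close>. Then \<open>L K' - L K = O(n)\<close> with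
  probability tending to one, and the penalty gap is larger, because \<open>n powr (3/2) * \<rho> powr (1/2)\<close>
  equals \<open>n * sqrt (n * \<rho>)\<close> and \<open>n * \<rho>\<close> tends to infinity.

  Too few blocks: once every true block contains a positive fraction of the nodes, which Hoeffding's
  inequality guarantees (\<open>prob_small_block_le\<close>), any labeling with fewer blocks puts large parts of two
  true blocks into one block. These two blocks have distinct columns in \<open>H\<close>, so \<open>D\<close> can be taken as
  a constant times \<open>n\<^sup>2 * \<rho>\<close> (\<open>merged_blocks_distance\<close>, \<open>hellinger_separation\<close>). This dominates the
  entropy \<open>n * ln K'\<close> of the labelings, and the choice \<open>t = - D / 2\<close> shows that \<open>L K\<close> exceeds \<open>L K'\<close>
  by an amount of order \<open>n\<^sup>2 * \<rho>\<close>, which is more than the penalty gap.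
\<close>

section \<open>The complete likelihood as a product over pairs of nodes\<close>

definition node_pairs :: "nat \<Rightarrow> (nat \<times> nat) set" where
  "node_pairs n = {(i, j). i \<in> {1..n} \<and> j \<in> {1..n} \<and> i < j}"

lemma finite_node_pairs [simp]: "finite (node_pairs n)"
  by (rule finite_subset[of _ "{1..n} \<times> {1..n}"]) (auto simp: node_pairs_def)

text \<open>
  Stated for every commutative monoid, because it serves both the likelihood (a product) and the
  Hellinger distance (a sum): ordered pairs visit each unordered pair twice.
\<close>

context comm_monoid_set
begin

lemma off_diagonal:
  assumes "\<And>i j. i \<in> {1..n} \<Longrightarrow> j \<in> {1..n} \<Longrightarrow> g i j = g j i"
  shows "F (\<lambda>i. F (\<lambda>j. g i j) ({1..n} - {i})) {1..n} =
    F (\<lambda>(i, j). g i j) (node_pairs n) \<^bold>* F (\<lambda>(i, j). g i j) (node_pairs n)"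
proof -
  have swap: "F (\<lambda>(i, j). g i j) (prod.swap ` node_pairs n) = F (\<lambda>(i, j). g i j) (node_pairs n)"
    by (subst reindex) (auto intro!: cong simp: node_pairs_def assms)
  have split: "(SIGMA i:{1..n}. {1..n} - {i}) = node_pairs n \<union> prod.swap ` node_pairs n"
    by (auto simp: node_pairs_def image_iff)
  have "F (\<lambda>i. F (\<lambda>j. g i j) ({1..n} - {i})) {1..n} =
      F (\<lambda>(i, j). g i j) (SIGMA i:{1..n}. {1..n} - {i})"
    by (subst Sigma) auto
  also have "\<dots> = F (\<lambda>(i, j). g i j) (node_pairs n) \<^bold>*
      F (\<lambda>(i, j). g i j) (prod.swap ` node_pairs n)"
    unfolding split by (rule union_disjoint) (auto simp flip: node_pairs_def, auto simp: node_pairs_def)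
  finally show ?thesis
    by (simp add: swap)
qed

end

definition bern :: "real \<Rightarrow> bool \<Rightarrow> real" where
  "bern q b = (if b then q else 1 - q)"

definition edge_lik :: "nat \<Rightarrow> (nat \<Rightarrow> nat \<Rightarrow> real) \<Rightarrow> (nat \<Rightarrow> nat) \<Rightarrow> adj \<Rightarrow> real" where
  "edge_lik n H z A = (\<Prod>(i, j)\<in>node_pairs n. bern (H (z i) (z j)) (A i j))"

text \<open>
  The product under the square root in \<open>complete_lik\<close>: the edge likelihood over ordered pairs,
  collected by pairs of blocks.
\<close>

definition profile_lik :: "nat \<Rightarrow> nat \<Rightarrow> (nat \<Rightarrow> nat \<Rightarrow> real) \<Rightarrow> (nat \<Rightarrow> nat) \<Rightarrow> adj \<Rightarrow> real" where
  "profile_lik n K H z A = (\<Prod>a\<in>{1..K}. \<Prod>b\<in>{1..K}.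
       H a b ^ block_edges n A z a b *
       (1 - H a b) ^ (block_pairs n z a b - block_edges n A z a b))"

lemma bern_nonneg: "0 \<le> q \<Longrightarrow> q \<le> 1 \<Longrightarrow> 0 \<le> bern q b"
  by (simp add: bern_def)

lemma bern_pos: "0 < q \<Longrightarrow> q < 1 \<Longrightarrow> 0 < bern q b"
  by (simp add: bern_def)

lemma non_edges_eq:
  "block_pairs n z a b - block_edges n A z a b =
     (\<Sum>i\<in>{1..n}. \<Sum>j\<in>{1..n} - {i}. of_bool (z i = a \<and> z j = b) * of_bool (\<not> A i j))"
proof -
  have "block_pairs n z a b = block_edges n A z a b +
     (\<Sum>i\<in>{1..n}. \<Sum>j\<in>{1..n} - {i}. of_bool (z i = a \<and> z j = b) * of_bool (\<not> A i j))"
    unfolding block_pairs_def block_edges_def sum.distrib[symmetric]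
    by (intro sum.cong refl) auto
  then show ?thesis by simp
qed

lemma power_of_bool_select:
  fixes x :: "nat \<Rightarrow> 'a :: comm_monoid_mult"
  assumes "c \<in> {1..K}"
  shows "(\<Prod>a\<in>{1..K}. x a ^ of_bool (c = a)) = x c"
proof -
  have "(\<Prod>a\<in>{1..K}. x a ^ of_bool (c = a)) = (\<Prod>a\<in>{1..K}. if c = a then x a else 1)"
    by (intro prod.cong) auto
  with assms show ?thesis by (simp add: prod.delta')
qed

lemma block_size_prod:
  assumes "z \<in> {1..n} \<rightarrow>\<^sub>E {1..K}"
  shows "(\<Prod>a\<in>{1..K}. p a ^ block_size n z a) = (\<Prod>i\<in>{1..n}. p (z i) :: real)"
proof -
  have "(\<Prod>a\<in>{1..K}. p a ^ block_size n z a) =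
      (\<Prod>i\<in>{1..n}. \<Prod>a\<in>{1..K}. p a ^ of_bool (z i = a))"
    unfolding block_size_def power_sum by (rule prod.swap)
  also have "\<dots> = (\<Prod>i\<in>{1..n}. p (z i))"
    using assms by (intro prod.cong refl power_of_bool_select) auto
  finally show ?thesis .
qed

text \<open>
  A power with an indicator sum as exponent is a product over the pairs of nodes. After interchanging
  the products, only the factor belonging to the actual labels of each pair survives.
\<close>

lemma profile_lik_ordered:
  assumes z: "z \<in> {1..n} \<rightarrow>\<^sub>E {1..K}"
  shows "profile_lik n K H z A =
    (\<Prod>i\<in>{1..n}. \<Prod>j\<in>{1..n} - {i}. bern (H (z i) (z j)) (A i j))"
proof -
  have "profile_lik n K H z A = (\<Prod>a\<in>{1..K}. \<Prod>b\<in>{1..K}. \<Prod>i\<in>{1..n}. \<Prod>j\<in>{1..n} - {i}.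
      (bern (H a b) (A i j) ^ of_bool (z j = b)) ^ of_bool (z i = a))"
    unfolding profile_lik_def non_edges_eq
    unfolding block_edges_def power_sum prod.distrib[symmetric]
    by (intro prod.cong refl) (auto simp: bern_def)
  also have "\<dots> = (\<Prod>i\<in>{1..n}. \<Prod>a\<in>{1..K}. \<Prod>j\<in>{1..n} - {i}. \<Prod>b\<in>{1..K}.
      (bern (H a b) (A i j) ^ of_bool (z j = b)) ^ of_bool (z i = a))"
    by (simp only: prod.swap[of _ "{1..n}" "{1..K}"] prod.swap[of _ "{1..n} - {_}" "{1..K}"])
  also have "\<dots> = (\<Prod>i\<in>{1..n}. \<Prod>j\<in>{1..n} - {i}. bern (H (z i) (z j)) (A i j))"
  proof (rule prod.cong[OF refl])
    fix i assume i: "i \<in> {1..n}"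
    have "(\<Prod>a\<in>{1..K}. \<Prod>j\<in>{1..n} - {i}. \<Prod>b\<in>{1..K}.
        (bern (H a b) (A i j) ^ of_bool (z j = b)) ^ of_bool (z i = a)) =
      (\<Prod>a\<in>{1..K}. (\<Prod>j\<in>{1..n} - {i}. bern (H a (z j)) (A i j)) ^ of_bool (z i = a))"
      unfolding prod_power_distrib
    proof (intro prod.cong refl)
      fix a j assume "j \<in> {1..n} - {i}"
      then have "z j \<in> {1..K}" using z by auto
      then show "(\<Prod>b\<in>{1..K}. (bern (H a b) (A i j) ^ of_bool (z j = b)) ^ of_bool (z i = a)) =
          bern (H a (z j)) (A i j) ^ of_bool (z i = a)"
        unfolding prod_power_distrib[symmetric] by (subst power_of_bool_select) auto
    qed
    also have "\<dots> = (\<Prod>j\<in>{1..n} - {i}. bern (H (z i) (z j)) (A i j))"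
      using z i by (intro power_of_bool_select) auto
    finally show "(\<Prod>a\<in>{1..K}. \<Prod>j\<in>{1..n} - {i}. \<Prod>b\<in>{1..K}.
        (bern (H a b) (A i j) ^ of_bool (z j = b)) ^ of_bool (z i = a)) =
      (\<Prod>j\<in>{1..n} - {i}. bern (H (z i) (z j)) (A i j))" .
  qed
  finally show ?thesis .
qed

lemma sqrt_profile_lik:
  assumes z: "z \<in> {1..n} \<rightarrow>\<^sub>E {1..K}" and A: "\<And>i j. A i j = A j i"
    and H: "\<And>a b. a \<in> {1..K} \<Longrightarrow> b \<in> {1..K} \<Longrightarrow> 0 \<le> H a b \<and> H a b \<le> 1 \<and> H a b = H b a"
  shows "sqrt (profile_lik n K H z A) = edge_lik n H z A"
proof -
  have zK: "z i \<in> {1..K}" if "i \<in> {1..n}" for i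
    using z that by auto
  have "profile_lik n K H z A = edge_lik n H z A * edge_lik n H z A"
    unfolding profile_lik_ordered[OF z] edge_lik_def
  proof (rule prod.off_diagonal)
    fix i j assume "i \<in> {1..n}" "j \<in> {1..n}"
    then have "H (z i) (z j) = H (z j) (z i)"
      using H zK by blast
    then show "bern (H (z i) (z j)) (A i j) = bern (H (z j) (z i)) (A j i)"
      using A[of i j] by simp
  qed
  moreover have "0 \<le> edge_lik n H z A"
    unfolding edge_lik_def
    using H zK by (intro prod_nonneg) (auto simp: node_pairs_def intro!: bern_nonneg)
  ultimately show ?thesis by simp
qed

lemma complete_lik_eq:
  assumes z: "z \<in> {1..n} \<rightarrow>\<^sub>E {1..K}" and A: "\<And>i j. A i j = A j i"
    and H: "\<And>a b. a \<in> {1..K} \<Longrightarrow> b \<in> {1..K} \<Longrightarrow> 0 \<le> H a b \<and> H a b \<le> 1 \<and> H a b = H b a"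
  shows "complete_lik n K z A (p, H) = (\<Prod>i\<in>{1..n}. p (z i)) * edge_lik n H z A"
  using sqrt_profile_lik[OF assms] block_size_prod[OF z, of p]
  unfolding complete_lik_def profile_lik_def by simp

section \<open>Hellinger affinity of two labelled models\<close>

text \<open>
  One minus the affinity is half the squared Hellinger distance; the part of that distance that comes
  from the probabilities of non-edges is dropped, and \<open>1 - x \<le> exp (- x)\<close> gives a form that multiplies
  well over independent edges.
\<close>

lemma bern_affinity_le:
  assumes "0 \<le> p" "p \<le> 1" "0 \<le> q" "q \<le> 1"
  shows "sqrt (p * q) + sqrt ((1 - p) * (1 - q)) \<le> exp (- (sqrt p - sqrt q)\<^sup>2 / 2)"
proof -
  have expand: "(sqrt x - sqrt y)\<^sup>2 = x + y - 2 * sqrt (x * y)" if "0 \<le> x" "0 \<le> y" for x y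
    using that by (simp add: power2_diff real_sqrt_mult)
  have "0 \<le> (sqrt (1 - p) - sqrt (1 - q))\<^sup>2"
    by simp
  then have "sqrt (p * q) + sqrt ((1 - p) * (1 - q)) \<le> 1 + - (sqrt p - sqrt q)\<^sup>2 / 2"
    using expand[of p q] expand[of "1 - p" "1 - q"] assms by linarith
  also have "\<dots> \<le> exp (- (sqrt p - sqrt q)\<^sup>2 / 2)"
    by (rule exp_ge_add_one_self)
  finally show ?thesis .
qed

lemma expectation_sqrt_bern_ratio:
  assumes "0 < p" "p < 1" "0 \<le> q" "q \<le> 1"
  shows "measure_pmf.expectation (bernoulli_pmf p) (\<lambda>e. sqrt (bern q e / bern p e)) =
    sqrt (p * q) + sqrt ((1 - p) * (1 - q))"
proof -
  have cancel: "r * sqrt (s / r) = sqrt (r * s)" if "0 < r" for r s :: real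
    using that by (simp add: real_sqrt_divide real_sqrt_mult field_simps)
  show ?thesis
    using assms cancel[of p q] cancel[of "1 - p" "1 - q"]
    by (simp add: bern_def mult.commute)
qed

lemma sqrt_prod: "sqrt (prod f X) = (\<Prod>x\<in>X. sqrt (f x))"
  by (induction X rule: infinite_finite_induct) (auto simp: real_sqrt_mult)

text \<open>
  The edges are independent given the labels, so the affinity of the two graph distributions is the
  product of the affinities over the pairs of nodes. The second matrix may take the boundary values
  0 and 1, since maximum likelihood estimates do.
\<close>

lemma graph_affinity:
  assumes H: "\<And>i j. (i, j) \<in> node_pairs n \<Longrightarrow> 0 < H (z i) (z j) \<and> H (z i) (z j) < 1"
    and Q: "\<And>i j. (i, j) \<in> node_pairs n \<Longrightarrow> 0 \<le> Q (w i) (w j) \<and> Q (w i) (w j) \<le> 1"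
    and D: "D \<le> (\<Sum>(i, j)\<in>node_pairs n. (sqrt (H (z i) (z j)) - sqrt (Q (w i) (w j)))\<^sup>2)"
  shows "measure_pmf.expectation (graph_pmf n H z)
      (\<lambda>A. sqrt (edge_lik n Q w A / edge_lik n H z A)) \<le> exp (- D / 2)"
proof -
  let ?G = "Pi_pmf (node_pairs n) False (\<lambda>(i, j). bernoulli_pmf (H (z i) (z j)))"
  define d where "d = (\<lambda>(i, j). (sqrt (H (z i) (z j)) - sqrt (Q (w i) (w j)))\<^sup>2)"
  let ?r = "\<lambda>(i, j) e. sqrt (bern (Q (w i) (w j)) e / bern (H (z i) (z j)) e)"
  have "measure_pmf.expectation (graph_pmf n H z)
      (\<lambda>A. sqrt (edge_lik n Q w A / edge_lik n H z A)) =
    measure_pmf.expectation ?G (\<lambda>E. \<Prod>x\<in>node_pairs n. ?r x (E x))"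
    unfolding graph_pmf_def node_pairs_def[symmetric] integral_map_pmf edge_lik_def
      prod_dividef[symmetric] sqrt_prod
    by (intro integral_cong refl arg_cong[where f = "measure_pmf.expectation _"] ext prod.cong)
       (auto simp: node_pairs_def min_def max_def)
  also have "\<dots> = (\<Prod>x\<in>node_pairs n. measure_pmf.expectation
      ((\<lambda>(i, j). bernoulli_pmf (H (z i) (z j))) x) (?r x))"
  proof (intro expectation_prod_Pi_pmf integrable_measure_pmf_finite, goal_cases)
    case (2 x)
    then show ?case by (cases x) simp
  next
    case (3 x e)
    then obtain i j where x: "x = (i, j)" and ij: "(i, j) \<in> node_pairs n"
      by (cases x) auto
    show ?case
      using bern_nonneg[of "H (z i) (z j)" e] bern_nonneg[of "Q (w i) (w j)" e] H[OF ij] Q[OF ij]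
      by (simp add: x)
  qed simp
  also have "\<dots> \<le> (\<Prod>x\<in>node_pairs n. exp (- d x / 2))"
  proof (rule prod_mono)
    fix x assume "x \<in> node_pairs n"
    then obtain i j where x: "x = (i, j)" and ij: "(i, j) \<in> node_pairs n"
      by (cases x) auto
    show "0 \<le> measure_pmf.expectation ((\<lambda>(i, j). bernoulli_pmf (H (z i) (z j))) x) (?r x) \<and>
      measure_pmf.expectation ((\<lambda>(i, j). bernoulli_pmf (H (z i) (z j))) x) (?r x) \<le>
      exp (- d x / 2)"
      using H[OF ij] Q[OF ij] expectation_sqrt_bern_ratio[of "H (z i) (z j)" "Q (w i) (w j)"]
        bern_affinity_le[of "H (z i) (z j)" "Q (w i) (w j)"]
      unfolding d_def x prod.case by auto
  qed
  also have "\<dots> = exp (\<Sum>x\<in>node_pairs n. - d x / 2)"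
    by (rule exp_sum[symmetric]) simp
  also have "\<dots> = exp (- sum d (node_pairs n) / 2)"
    by (simp add: sum_negf sum_divide_distrib)
  also have "\<dots> \<le> exp (- D / 2)"
    using D unfolding d_def by simp
  finally show ?thesis .
qed

section \<open>Finitely many maximum likelihood estimates\<close>

text \<open>
  A maximiser of the likelihood of \<open>k\<close> successes in \<open>m\<close> trials over the compact interval from 0 to
  1. The point is that it depends on the data through \<open>m\<close> and \<open>k\<close> only.
\<close>

definition bern_mle :: "nat \<Rightarrow> nat \<Rightarrow> real" where
  "bern_mle m k = (SOME q. 0 \<le> q \<and> q \<le> 1 \<and>
     (\<forall>x. 0 \<le> x \<and> x \<le> 1 \<longrightarrow> x ^ k * (1 - x) ^ (m - k) \<le> q ^ k * (1 - q) ^ (m - k)))"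

lemma bern_mle:
  "0 \<le> bern_mle m k" "bern_mle m k \<le> 1"
  "0 \<le> x \<Longrightarrow> x \<le> 1 \<Longrightarrow>
    x ^ k * (1 - x) ^ (m - k) \<le> bern_mle m k ^ k * (1 - bern_mle m k) ^ (m - k)"
proof -
  have "\<exists>q\<in>{0..1::real}. \<forall>x\<in>{0..1}. x ^ k * (1 - x) ^ (m - k) \<le> q ^ k * (1 - q) ^ (m - k)"
    by (intro continuous_attains_sup continuous_intros) auto
  then have "\<exists>q::real. 0 \<le> q \<and> q \<le> 1 \<and>
     (\<forall>x. 0 \<le> x \<and> x \<le> 1 \<longrightarrow> x ^ k * (1 - x) ^ (m - k) \<le> q ^ k * (1 - q) ^ (m - k))"
    by auto
  from someI_ex[OF this, folded bern_mle_def]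
  show "0 \<le> bern_mle m k" "bern_mle m k \<le> 1"
    "0 \<le> x \<Longrightarrow> x \<le> 1 \<Longrightarrow>
      x ^ k * (1 - x) ^ (m - k) \<le> bern_mle m k ^ k * (1 - bern_mle m k) ^ (m - k)"
    by blast+
qed

text \<open>
  All matrices that can occur as block edge counts of a graph on \<open>n\<close> nodes. Symmetry is built in so
  that the resulting estimates are symmetric matrices.
\<close>

definition edge_counts :: "nat \<Rightarrow> nat \<Rightarrow> (nat \<times> nat \<Rightarrow> nat) set" where
  "edge_counts n K = {c \<in> {1..K} \<times> {1..K} \<rightarrow>\<^sub>E {..n\<^sup>2}.
     \<forall>a\<in>{1..K}. \<forall>b\<in>{1..K}. c (a, b) = c (b, a)}"

definition mle_matrix :: "nat \<Rightarrow> (nat \<Rightarrow> nat) \<Rightarrow> (nat \<times> nat \<Rightarrow> nat) \<Rightarrow> nat \<Rightarrow> nat \<Rightarrow> real" where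
  "mle_matrix n z c a b = bern_mle (block_pairs n z a b) (c (a, b))"

lemma finite_edge_counts [simp]: "finite (edge_counts n K)"
  unfolding edge_counts_def
  by (rule finite_subset[of _ "{1..K} \<times> {1..K} \<rightarrow>\<^sub>E {..n\<^sup>2}"]) (auto intro: finite_PiE)

lemma card_edge_counts_le: "card (edge_counts n K) \<le> (n\<^sup>2 + 1) ^ K\<^sup>2"
proof -
  have "card (edge_counts n K) \<le> card ({1..K} \<times> {1..K} \<rightarrow>\<^sub>E {..n\<^sup>2})"
    unfolding edge_counts_def by (intro card_mono finite_PiE) auto
  also have "\<dots> = (n\<^sup>2 + 1) ^ K\<^sup>2"
    by (simp add: card_PiE power2_eq_square)
  finally show ?thesis .
qed

lemma double_sum_off_diagonal_swap:
  fixes f :: "nat \<Rightarrow> nat \<Rightarrow> nat"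
  shows "(\<Sum>i\<in>{1..n}. \<Sum>j\<in>{1..n} - {i}. f i j) = (\<Sum>i\<in>{1..n}. \<Sum>j\<in>{1..n} - {i}. f j i)"
proof -
  have *: "(\<Sum>j\<in>{1..n} - {i}. g j) = (\<Sum>j\<in>{1..n}. if i = j then 0 else g j)"
    for i and g :: "nat \<Rightarrow> nat"
    by (intro sum.mono_neutral_cong_left) auto
  show ?thesis
    unfolding * by (rule trans[OF sum.swap]) (intro sum.cong refl, auto)
qed

lemma block_pairs_sym: "block_pairs n z a b = block_pairs n z b a"
  unfolding block_pairs_def
proof (rule trans[OF double_sum_off_diagonal_swap], intro sum.cong refl)
  fix i j
  show "of_bool (z j = a \<and> z i = b) = (of_bool (z i = b \<and> z j = a) :: nat)"
    by auto
qed

lemma block_edges_sym: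
  assumes "\<And>i j. A i j = A j i"
  shows "block_edges n A z a b = block_edges n A z b a"
  unfolding block_edges_def
proof (rule trans[OF double_sum_off_diagonal_swap], intro sum.cong refl)
  fix i j
  show "of_bool (z j = a \<and> z i = b) * of_bool (A j i) =
      (of_bool (z i = b \<and> z j = a) * of_bool (A i j) :: nat)"
    using assms[of i j] by auto
qed

lemma block_edges_le: "block_edges n A z a b \<le> n\<^sup>2"
proof -
  have "block_edges n A z a b \<le> (\<Sum>i\<in>{1..n}. \<Sum>j\<in>{1..n} - {i}. 1)"
    unfolding block_edges_def by (intro sum_mono) auto
  also have "\<dots> \<le> (\<Sum>i\<in>{1..n}. n)"
    by (intro sum_mono) (auto intro: order_trans[OF card_Diff1_le])
  finally show ?thesis by (simp add: power2_eq_square)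
qed

lemma mle_matrix_props:
  assumes "c \<in> edge_counts n K" "a \<in> {1..K}" "b \<in> {1..K}"
  shows "0 \<le> mle_matrix n z c a b \<and> mle_matrix n z c a b \<le> 1 \<and>
    mle_matrix n z c a b = mle_matrix n z c b a"
proof -
  have "c (a, b) = c (b, a)"
    using assms unfolding edge_counts_def by blast
  then show ?thesis
    using bern_mle(1,2) block_pairs_sym[of n z a b] unfolding mle_matrix_def by simp
qed

text \<open>
  The edge likelihood of a labeling factors over pairs of blocks, so it can be maximised blockwise,
  and the maximiser is determined by the block edge counts of the graph. This replaces the supremum
  over a continuum of matrices by a maximum over polynomially many.
\<close>

lemma edge_lik_le_mle:
  assumes z: "z \<in> {1..n} \<rightarrow>\<^sub>E {1..K}" and A: "\<And>i j. A i j = A j i"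
    and H: "\<And>a b. a \<in> {1..K} \<Longrightarrow> b \<in> {1..K} \<Longrightarrow> 0 \<le> H a b \<and> H a b \<le> 1 \<and> H a b = H b a"
  shows "\<exists>c\<in>edge_counts n K. edge_lik n H z A \<le> edge_lik n (mle_matrix n z c) z A"
proof -
  define c where "c = (\<lambda>(a, b)\<in>{1..K} \<times> {1..K}. block_edges n A z a b)"
  have c: "c \<in> edge_counts n K"
    by (auto simp: edge_counts_def c_def block_edges_le block_edges_sym[OF A])
  have e1: "sqrt (profile_lik n K H z A) = edge_lik n H z A"
    using z A H by (rule sqrt_profile_lik)
  have e2: "sqrt (profile_lik n K (mle_matrix n z c) z A) = edge_lik n (mle_matrix n z c) z A"
    using z A mle_matrix_props[OF c] by (rule sqrt_profile_lik)
  have "profile_lik n K H z A \<le> profile_lik n K (mle_matrix n z c) z A"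
    unfolding profile_lik_def
    by (intro prod_mono conjI prod_nonneg)
       (use H bern_mle(3) in \<open>auto simp: mle_matrix_def c_def\<close>)
  then have "sqrt (profile_lik n K H z A) \<le> sqrt (profile_lik n K (mle_matrix n z c) z A)"
    by simp
  then have "edge_lik n H z A \<le> edge_lik n (mle_matrix n z c) z A"
    unfolding e1 e2 .
  with c show ?thesis by blast
qed

section \<open>Bounds for the maximal log-likelihood\<close>

lemma Theta_probs:
  assumes "(p, H) \<in> Theta K" "a \<in> {1..K}"
  shows "0 < p a" "p a \<le> 1"
proof -
  have "0 < p a \<and> p a \<le> 1"
  proof (cases "K = 1")
    case False
    then have "0 < p a \<and> p a < 1"
      using assms unfolding Theta_def by auto
    then show ?thesis by simp
  qed (use assms in \<open>auto simp: Theta_def\<close>)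
  then show "0 < p a" "p a \<le> 1" by auto
qed

lemma Theta_probs_sum:
  assumes "(p, H) \<in> Theta K"
  shows "(\<Sum>a\<in>{1..K}. p a) = 1"
  using assms by (auto simp: Theta_def split: if_splits)

lemma Theta_matrix:
  assumes "(p, H) \<in> Theta K" "a \<in> {1..K}" "b \<in> {1..K}"
  shows "0 < H a b \<and> H a b < 1 \<and> H a b = H b a"
  using assms unfolding Theta_def by blast

lemma Theta_nonempty:
  assumes "1 \<le> K"
  shows "Theta K \<noteq> {}"
proof -
  have "(\<lambda>_. 1 / real K, \<lambda>_ _. 1 / 2) \<in> Theta K"
    using assms by (auto simp: Theta_def)
  then show ?thesis by blast
qed

lemma edge_lik_nonneg:
  assumes "\<And>i j. (i, j) \<in> node_pairs n \<Longrightarrow> 0 \<le> H (z i) (z j) \<and> H (z i) (z j) \<le> 1"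
  shows "0 \<le> edge_lik n H z A"
  using assms unfolding edge_lik_def by (force intro!: prod_nonneg bern_nonneg)

lemma edge_lik_pos:
  assumes "\<And>i j. (i, j) \<in> node_pairs n \<Longrightarrow> 0 < H (z i) (z j) \<and> H (z i) (z j) < 1"
  shows "0 < edge_lik n H z A"
  using assms unfolding edge_lik_def by (force intro!: prod_pos bern_pos)

lemma labels_of_pair:
  assumes "z \<in> {1..n} \<rightarrow>\<^sub>E {1..K}" "(i, j) \<in> node_pairs n"
  shows "z i \<in> {1..K}" "z j \<in> {1..K}"
  using assms by (auto simp: node_pairs_def)

lemma complete_lik_pos:
  assumes \<theta>: "(p, H) \<in> Theta K" and z: "z \<in> {1..n} \<rightarrow>\<^sub>E {1..K}" and A: "\<And>i j. A i j = A j i"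
  shows "0 < complete_lik n K z A (p, H)"
proof -
  have "complete_lik n K z A (p, H) = (\<Prod>i\<in>{1..n}. p (z i)) * edge_lik n H z A"
    using z A by (rule complete_lik_eq) (use Theta_matrix[OF \<theta>] in \<open>auto simp: less_imp_le\<close>)
  moreover have "0 < edge_lik n H z A"
    by (intro edge_lik_pos) (use Theta_matrix[OF \<theta>] labels_of_pair[OF z] in blast)
  moreover have "0 < (\<Prod>i\<in>{1..n}. p (z i))"
    by (intro prod_pos Theta_probs[OF \<theta>] ballI PiE_mem[OF z])
  ultimately show ?thesis by simp
qed

lemma marginal_lik_pos:
  assumes "1 \<le> K" "\<theta> \<in> Theta K" "\<And>i j. A i j = A j i"
  shows "0 < marginal_lik n K A \<theta>"
  unfolding marginal_lik_def
proof (rule sum_pos)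
  show "finite ({1..n} \<rightarrow>\<^sub>E {1..K})"
    by (intro finite_PiE) auto
  show "{1..n} \<rightarrow>\<^sub>E {1..K} \<noteq> {}"
    using assms(1) by (auto simp: PiE_eq_empty_iff)
  show "0 < complete_lik n K z A \<theta>" if "z \<in> {1..n} \<rightarrow>\<^sub>E {1..K}" for z
    using complete_lik_pos[of "fst \<theta>" "snd \<theta>" K z n A] that assms by simp
qed

lemma sqrt_sum_le:
  assumes "\<And>x. x \<in> X \<Longrightarrow> 0 \<le> f x"
  shows "sqrt (sum f X) \<le> (\<Sum>x\<in>X. sqrt (f x))"
  using assms
proof (induction X rule: infinite_finite_induct)
  case (insert x X)
  then have "sqrt (f x + sum f X) \<le> sqrt (f x) + sqrt (sum f X)"
    by (intro sqrt_add_le_add_sqrt sum_nonneg) auto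
  with insert show ?case by fastforce
qed auto

text \<open>
  A bound for the square root of the maximal likelihood. Square roots are taken summand by summand,
  since the affinity controls the expectation of the root of each single likelihood ratio.
\<close>

definition root_lik_bound :: "nat \<Rightarrow> nat \<Rightarrow> adj \<Rightarrow> real" where
  "root_lik_bound n K A =
     (\<Sum>z\<in>{1..n} \<rightarrow>\<^sub>E {1..K}. \<Sum>c\<in>edge_counts n K. sqrt (edge_lik n (mle_matrix n z c) z A))"

lemma mle_matrix_pair:
  assumes "c \<in> edge_counts n K" "z \<in> {1..n} \<rightarrow>\<^sub>E {1..K}" "(i, j) \<in> node_pairs n"
  shows "0 \<le> mle_matrix n z c (z i) (z j) \<and> mle_matrix n z c (z i) (z j) \<le> 1"
  using mle_matrix_props[OF assms(1) labels_of_pair[OF assms(2,3)]] by blast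

lemma sqrt_marginal_lik_le:
  assumes \<theta>: "\<theta> \<in> Theta K" and A: "\<And>i j. A i j = A j i"
  shows "sqrt (marginal_lik n K A \<theta>) \<le> root_lik_bound n K A"
proof -
  obtain p H where pH: "\<theta> = (p, H)" by (cases \<theta>)
  note \<theta>' = \<theta>[unfolded pH]
  have term_le: "sqrt (complete_lik n K z A \<theta>) \<le>
      (\<Sum>c\<in>edge_counts n K. sqrt (edge_lik n (mle_matrix n z c) z A))"
    if z: "z \<in> {1..n} \<rightarrow>\<^sub>E {1..K}" for z
  proof -
    have H01: "0 \<le> H a b \<and> H a b \<le> 1 \<and> H a b = H b a" if "a \<in> {1..K}" "b \<in> {1..K}" for a b
      using Theta_matrix[OF \<theta>' that] by auto
    obtain c where c: "c \<in> edge_counts n K"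
      and le: "edge_lik n H z A \<le> edge_lik n (mle_matrix n z c) z A"
      using edge_lik_le_mle[of z n K A H] z A H01 by blast
    have "complete_lik n K z A \<theta> = (\<Prod>i\<in>{1..n}. p (z i)) * edge_lik n H z A"
      unfolding pH using z A H01 by (rule complete_lik_eq)
    also have "\<dots> \<le> 1 * edge_lik n H z A"
    proof (rule mult_right_mono)
      show "(\<Prod>i\<in>{1..n}. p (z i)) \<le> 1"
        by (intro prod_le_1 conjI less_imp_le[OF Theta_probs(1)[OF \<theta>']] Theta_probs(2)[OF \<theta>']
            PiE_mem[OF z])
      show "0 \<le> edge_lik n H z A"
        by (intro edge_lik_nonneg) (use H01 labels_of_pair[OF z] in blast)
    qed
    also have "\<dots> \<le> edge_lik n (mle_matrix n z c) z A"
      using le by simp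
    finally have "sqrt (complete_lik n K z A \<theta>) \<le> sqrt (edge_lik n (mle_matrix n z c) z A)"
      by simp
    also have "\<dots> \<le> (\<Sum>c\<in>edge_counts n K. sqrt (edge_lik n (mle_matrix n z c) z A))"
      using c by (intro member_le_sum) (auto intro!: edge_lik_nonneg mle_matrix_pair[OF _ z])
    finally show ?thesis .
  qed
  have "sqrt (marginal_lik n K A \<theta>) \<le> (\<Sum>z\<in>{1..n} \<rightarrow>\<^sub>E {1..K}. sqrt (complete_lik n K z A \<theta>))"
    unfolding marginal_lik_def pH
    by (intro sqrt_sum_le less_imp_le complete_lik_pos[OF \<theta>'] A)
  also have "\<dots> \<le> root_lik_bound n K A"
    unfolding root_lik_bound_def by (intro sum_mono term_le)
  finally show ?thesis .
qed

definition log_lik :: "nat \<Rightarrow> nat \<Rightarrow> adj \<Rightarrow> real" where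
  "log_lik n K A = (SUP \<theta>\<in>Theta K. ln (marginal_lik n K A \<theta>))"

lemma ln_marginal_lik_le:
  assumes "1 \<le> K" "\<theta> \<in> Theta K" "\<And>i j. A i j = A j i"
  shows "ln (marginal_lik n K A \<theta>) \<le> 2 * ln (root_lik_bound n K A)" "0 < root_lik_bound n K A"
proof -
  let ?g = "marginal_lik n K A \<theta>"
  have g: "0 < ?g"
    using assms by (rule marginal_lik_pos)
  have le: "sqrt ?g \<le> root_lik_bound n K A"
    using assms(2,3) by (rule sqrt_marginal_lik_le)
  show pos: "0 < root_lik_bound n K A"
    using le g by (smt (verit) real_sqrt_gt_zero)
  have "ln (sqrt ?g) \<le> ln (root_lik_bound n K A)"
    using le g pos by (subst ln_le_cancel_iff) auto
  then show "ln ?g \<le> 2 * ln (root_lik_bound n K A)"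
    using g by (simp add: ln_sqrt)
qed

lemma exp_half_log_lik_le:
  assumes K: "1 \<le> K" and A: "\<And>i j. A i j = A j i"
  shows "exp (log_lik n K A / 2) \<le> root_lik_bound n K A"
proof -
  obtain \<theta> where \<theta>: "\<theta> \<in> Theta K"
    using Theta_nonempty[OF K] by blast
  have "log_lik n K A \<le> 2 * ln (root_lik_bound n K A)"
    unfolding log_lik_def
    using Theta_nonempty[OF K] by (rule cSUP_least) (rule ln_marginal_lik_le(1)[OF K _ A])
  then have "log_lik n K A / 2 \<le> ln (root_lik_bound n K A)"
    by simp
  moreover have "0 < root_lik_bound n K A"
    using K \<theta> A by (rule ln_marginal_lik_le(2))
  ultimately show ?thesis
    by (metis ln_ge_iff)
qed

text \<open>
  The labeling \<open>z\<close> is one summand of the marginal likelihood, and its label probabilities contribute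
  at least \<open>q ^ n\<close>.
\<close>

lemma log_lik_ge:
  assumes K: "1 \<le> K" and \<theta>: "(p, H) \<in> Theta K" and A: "\<And>i j. A i j = A j i"
    and z: "z \<in> {1..n} \<rightarrow>\<^sub>E {1..K}" and q: "0 < q" "\<And>a. a \<in> {1..K} \<Longrightarrow> q \<le> p a"
  shows "ln (edge_lik n H z A) + real n * ln q \<le> log_lik n K A"
proof -
  have e: "0 < edge_lik n H z A"
    by (intro edge_lik_pos) (use Theta_matrix[OF \<theta>] labels_of_pair[OF z] in blast)
  have "q ^ n = (\<Prod>i\<in>{1..n}. q)"
    by simp
  also have "\<dots> \<le> (\<Prod>i\<in>{1..n}. p (z i))"
    using q by (intro prod_mono conjI less_imp_le[OF q(1)] q(2) PiE_mem[OF z])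
  finally have "q ^ n * edge_lik n H z A \<le> (\<Prod>i\<in>{1..n}. p (z i)) * edge_lik n H z A"
    using e by (intro mult_right_mono) auto
  also have "\<dots> = complete_lik n K z A (p, H)"
    using z A by (rule complete_lik_eq[symmetric])
      (use Theta_matrix[OF \<theta>] in \<open>auto simp: less_imp_le\<close>)
  also have "\<dots> \<le> marginal_lik n K A (p, H)"
    unfolding marginal_lik_def
    by (intro member_le_sum z finite_PiE less_imp_le complete_lik_pos[OF \<theta> _ A]) auto
  finally have le: "q ^ n * edge_lik n H z A \<le> marginal_lik n K A (p, H)" .
  have "ln (edge_lik n H z A) + real n * ln q = ln (q ^ n * edge_lik n H z A)"
    using e q by (simp add: ln_mult ln_realpow)
  also have "\<dots> \<le> ln (marginal_lik n K A (p, H))"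
    using le e q marginal_lik_pos[OF K \<theta> A] by (subst ln_le_cancel_iff) auto
  also have "\<dots> \<le> log_lik n K A"
    unfolding log_lik_def
  proof (rule cSUP_upper[OF \<theta>])
    show "bdd_above ((\<lambda>\<theta>. ln (marginal_lik n K A \<theta>)) ` Theta K)"
      by (rule bdd_aboveI2) (rule ln_marginal_lik_le(1)[OF K _ A])
  qed
  finally show ?thesis .
qed

lemma set_graph_pmf_sym:
  assumes "A \<in> set_pmf (graph_pmf n H z)"
  shows "A i j = A j i"
  using assms by (auto simp: graph_pmf_def min.commute max.commute)

lemma finite_set_graph_pmf: "finite (set_pmf (graph_pmf n H z))"
  unfolding graph_pmf_def node_pairs_def[symmetric]
  by (auto simp: set_Pi_pmf intro!: finite_imageI finite_PiE_dflt)

text \<open>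
  The central estimate. On the event, \<open>root_lik_bound\<close> divided by the root of the true likelihood is
  at least \<open>exp (t / 2)\<close>. The expectation of this quotient is a sum of affinities, each at most \<open>exp (- D / 2)\<close>, over all labelings and all
  candidate estimates. For negative \<open>t\<close> it says that a model at Hellinger distance \<open>D\<close> from the truth
  falls short of the true likelihood.
\<close>

lemma prob_log_lik_exceeds_le:
  assumes K: "1 \<le> K"
    and H: "\<And>i j. (i, j) \<in> node_pairs n \<Longrightarrow> 0 < H (z i) (z j) \<and> H (z i) (z j) < 1"
    and D: "\<And>w Q. w \<in> {1..n} \<rightarrow>\<^sub>E {1..K} \<Longrightarrow>
      (\<And>a b. a \<in> {1..K} \<Longrightarrow> b \<in> {1..K} \<Longrightarrow> 0 \<le> Q a b \<and> Q a b \<le> 1 \<and> Q a b = Q b a) \<Longrightarrow>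
      D \<le> (\<Sum>(i, j)\<in>node_pairs n. (sqrt (H (z i) (z j)) - sqrt (Q (w i) (w j)))\<^sup>2)"
  shows "measure_pmf.prob (graph_pmf n H z) {A. ln (edge_lik n H z A) + t \<le> log_lik n K A} \<le>
    real K ^ n * real ((n\<^sup>2 + 1) ^ K\<^sup>2) * exp (- (t + D) / 2)"
proof -
  let ?M = "graph_pmf n H z" and ?L = "{1..n} \<rightarrow>\<^sub>E {1..K}"
  let ?r = "\<lambda>w c A. sqrt (edge_lik n (mle_matrix n w c) w A / edge_lik n H z A)"
  define X where "X A = (\<Sum>w\<in>?L. \<Sum>c\<in>edge_counts n K. ?r w c A)" for A
  note fin = finite_set_graph_pmf[of n H z]
  have e: "0 < edge_lik n H z A" for A
    using H by (rule edge_lik_pos)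
  have X_eq: "X A = root_lik_bound n K A / sqrt (edge_lik n H z A)" for A
    by (simp add: X_def root_lik_bound_def real_sqrt_divide sum_divide_distrib)
  have X_nonneg: "0 \<le> X A" for A
    unfolding X_def
    by (intro sum_nonneg real_sqrt_ge_zero divide_nonneg_nonneg edge_lik_nonneg mle_matrix_pair
        less_imp_le[OF e])
  have X_ge: "exp (t / 2) \<le> X A"
    if A: "A \<in> set_pmf ?M" and ge: "ln (edge_lik n H z A) + t \<le> log_lik n K A" for A
  proof -
    have "sqrt (edge_lik n H z A) * exp (t / 2) = exp ((ln (edge_lik n H z A) + t) / 2)"
      using e[of A] by (simp add: add_divide_distrib exp_add ln_sqrt[symmetric])
    also have "\<dots> \<le> exp (log_lik n K A / 2)"
      using ge by simp
    also have "\<dots> \<le> root_lik_bound n K A"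
      using K set_graph_pmf_sym[OF A] by (rule exp_half_log_lik_le)
    finally show ?thesis
      using e[of A] unfolding X_eq by (simp add: field_simps)
  qed
  have "measure_pmf.prob ?M {A. ln (edge_lik n H z A) + t \<le> log_lik n K A} \<le>
      measure_pmf.prob ?M {A. exp (t / 2) \<le> X A}"
    by (intro measure_pmf.finite_measure_mono_AE) (auto simp: AE_measure_pmf_iff X_ge)
  also have "\<dots> \<le> measure_pmf.expectation ?M X / exp (t / 2)"
    using integral_Markov_inequality_measure[of "measure_pmf ?M" X UNIV "exp (t / 2)"]
    by (simp add: integrable_measure_pmf_finite fin X_nonneg)
  also have "measure_pmf.expectation ?M X =
      (\<Sum>w\<in>?L. \<Sum>c\<in>edge_counts n K. measure_pmf.expectation ?M (?r w c))"
    unfolding X_def by (simp add: integrable_measure_pmf_finite fin)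
  also have "\<dots> \<le> (\<Sum>w\<in>?L. \<Sum>c\<in>edge_counts n K. exp (- D / 2))"
  proof (intro sum_mono)
    fix w c assume w: "w \<in> ?L" and c: "c \<in> edge_counts n K"
    show "measure_pmf.expectation ?M (?r w c) \<le> exp (- D / 2)"
      using H mle_matrix_pair[OF c w] D[OF w mle_matrix_props[OF c]] by (rule graph_affinity)
  qed
  also have "\<dots> = real K ^ n * real (card (edge_counts n K)) * exp (- D / 2)"
    by (simp add: card_PiE)
  also have "\<dots> \<le> real K ^ n * real ((n\<^sup>2 + 1) ^ K\<^sup>2) * exp (- D / 2)"
    by (intro mult_right_mono mult_left_mono of_nat_mono card_edge_counts_le) auto
  finally have "measure_pmf.prob ?M {A. ln (edge_lik n H z A) + t \<le> log_lik n K A} \<le>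
      real K ^ n * real ((n\<^sup>2 + 1) ^ K\<^sup>2) * exp (- D / 2) / exp (t / 2)"
    by (simp add: divide_right_mono)
  also have "\<dots> = real K ^ n * real ((n\<^sup>2 + 1) ^ K\<^sup>2) * exp (- (t + D) / 2)"
  proof -
    have "- (t + D) / 2 = - D / 2 - t / 2"
      by (simp add: field_simps)
    then show ?thesis by (simp only: exp_diff times_divide_eq_right)
  qed
  finally show ?thesis .
qed

section \<open>Labelings with fewer blocks merge two true blocks\<close>

lemma block_size_eq_card: "block_size n z a = card {i \<in> {1..n}. z i = a}"
  by (simp add: block_size_def Int_def)

text \<open>
  By the pigeonhole principle every true block \<open>a\<close> has more than \<open>m\<close> nodes in some block \<open>\<phi> a\<close> of \<open>w\<close>,
  and since \<open>w\<close> has fewer blocks, \<open>\<phi> a = \<phi> b\<close> for some \<open>a \<noteq> b\<close>. Take a row \<open>c\<close> that tells the columns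
  \<open>a\<close> and \<open>b\<close> apart. Between the nodes of \<open>c\<close> in \<open>\<phi> c\<close> and those of \<open>a\<close> and \<open>b\<close> in \<open>\<phi> a\<close> the model
  uses a single value of \<open>q\<close>, which cannot be close to both \<open>r c a\<close> and \<open>r c b\<close>. Counting more than
  \<open>m\<close> nodes leaves at least \<open>m\<close> of them after the diagonal has been removed.
\<close>

lemma merged_blocks_distance:
  fixes r q :: "nat \<Rightarrow> nat \<Rightarrow> real"
  assumes K': "K' < K" and \<kappa>_nonneg: "0 \<le> \<kappa>"
    and w: "w \<in> {1..n} \<rightarrow>\<^sub>E {1..K'}"
    and big: "\<And>a. a \<in> {1..K} \<Longrightarrow> K' * m < block_size n z a"
    and gap: "\<And>a b. a \<in> {1..K} \<Longrightarrow> b \<in> {1..K} \<Longrightarrow> a \<noteq> b \<Longrightarrow>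
      \<exists>c\<in>{1..K}. \<kappa> \<le> (r c a - r c b)\<^sup>2"
  shows "real m * real m * \<kappa> / 2 \<le>
    (\<Sum>i\<in>{1..n}. \<Sum>j\<in>{1..n} - {i}. (r (z i) (z j) - q (w i) (w j))\<^sup>2)"
proof -
  define W where "W a u = {i \<in> {1..n}. z i = a \<and> w i = u}" for a u
  have W_sub: "W a u \<subseteq> {1..n}" and fin_W: "finite (W a u)" for a u
    by (auto simp: W_def)
  have "\<exists>u\<in>{1..K'}. m < card (W a u)" if a: "a \<in> {1..K}" for a
  proof (rule ccontr)
    assume "\<not> ?thesis"
    then have "(\<Sum>u\<in>{1..K'}. card (W a u)) \<le> (\<Sum>u\<in>{1..K'}. m)"
      by (intro sum_mono) (auto simp: not_less)
    moreover have "block_size n z a \<le> (\<Sum>u\<in>{1..K'}. card (W a u))"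
    proof -
      have "{i \<in> {1..n}. z i = a} = (\<Union>u\<in>{1..K'}. W a u)"
        using PiE_mem[OF w] by (auto simp: W_def)
      then show ?thesis
        unfolding block_size_eq_card by (simp add: card_UN_le)
    qed
    ultimately show False using big[OF a] by simp
  qed
  then obtain \<phi> where \<phi>: "\<And>a. a \<in> {1..K} \<Longrightarrow> \<phi> a \<in> {1..K'} \<and> m < card (W a (\<phi> a))"
    by metis
  have "\<not> inj_on \<phi> {1..K}"
  proof
    assume "inj_on \<phi> {1..K}"
    then have "card {1..K} \<le> card {1..K'}"
      using \<phi> by (intro card_inj_on_le[of \<phi>]) auto
    with K' show False by simp
  qed
  then obtain a b where ab: "a \<in> {1..K}" "b \<in> {1..K}" "a \<noteq> b" "\<phi> a = \<phi> b"
    by (auto simp: inj_on_def)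
  obtain c where c: "c \<in> {1..K}" and \<kappa>: "\<kappa> \<le> (r c a - r c b)\<^sup>2"
    using gap[OF ab(1-3)] by blast
  define s where "s = q (\<phi> c) (\<phi> a)"
  let ?V = "W c (\<phi> c)" and ?A = "W a (\<phi> a)" and ?B = "W b (\<phi> a)"
  let ?g = "\<lambda>i j. (r (z i) (z j) - q (w i) (w j))\<^sup>2"
  have card_minus: "m \<le> card (X - {i})" if "m < card X" for X :: "nat set" and i
    using that by (cases "finite X") (auto simp: card_Diff_singleton_if)
  have row: "real m * \<kappa> / 2 \<le> (\<Sum>j\<in>{1..n} - {i}. ?g i j)" if i: "i \<in> ?V" for i
  proof -
    have "\<kappa> / 2 \<le> (r c a - s)\<^sup>2 + (r c b - s)\<^sup>2"
    proof -
      have "(r c a - r c b)\<^sup>2 \<le> 2 * (r c a - s)\<^sup>2 + 2 * (r c b - s)\<^sup>2"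
        using zero_le_power2[of "(r c a - s) + (r c b - s)"]
        by (simp add: power2_eq_square algebra_simps)
      with \<kappa> show ?thesis by linarith
    qed
    then have "real m * (\<kappa> / 2) \<le> real m * ((r c a - s)\<^sup>2 + (r c b - s)\<^sup>2)"
      by (rule mult_left_mono) simp
    also have "\<dots> = real m * (r c a - s)\<^sup>2 + real m * (r c b - s)\<^sup>2"
      by (simp add: distrib_left)
    also have "\<dots> \<le> real (card (?A - {i})) * (r c a - s)\<^sup>2 + real (card (?B - {i})) * (r c b - s)\<^sup>2"
      using \<phi>[OF ab(1)] \<phi>[OF ab(2)] ab(4)
      by (intro add_mono mult_right_mono of_nat_mono card_minus) auto
    also have "\<dots> = (\<Sum>j\<in>?A - {i}. ?g i j) + (\<Sum>j\<in>?B - {i}. ?g i j)"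
      using i by (simp add: W_def s_def)
    also have "\<dots> = (\<Sum>j\<in>(?A - {i}) \<union> (?B - {i}). ?g i j)"
      using ab(3) fin_W by (intro sum.union_disjoint[symmetric]) (auto simp: W_def)
    also have "\<dots> \<le> (\<Sum>j\<in>{1..n} - {i}. ?g i j)"
      by (intro sum_mono2) (auto simp: W_def)
    finally show ?thesis by simp
  qed
  have "real m * real m * \<kappa> / 2 \<le> real (card ?V) * (real m * \<kappa> / 2)"
    using \<phi>[OF c] \<kappa>_nonneg by (auto intro!: divide_right_mono mult_right_mono simp: mult.assoc)
  also have "\<dots> = (\<Sum>i\<in>?V. real m * \<kappa> / 2)"
    by simp
  also have "\<dots> \<le> (\<Sum>i\<in>?V. \<Sum>j\<in>{1..n} - {i}. ?g i j)"
    by (intro sum_mono row)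
  also have "\<dots> \<le> (\<Sum>i\<in>{1..n}. \<Sum>j\<in>{1..n} - {i}. ?g i j)"
    by (intro sum_mono2 W_sub sum_nonneg) auto
  finally show ?thesis .
qed

section \<open>Distribution of labels and block sizes\<close>

lemma pmf_label_pmf:
  assumes "(p, H) \<in> Theta K"
  shows "pmf (label_pmf K p) a = (if a \<in> {1..K} then p a else 0)"
  unfolding label_pmf_def
proof (rule pmf_embed_pmf)
  show "0 \<le> (if a \<in> {1..K} then p a else 0)" for a
    using Theta_probs(1)[OF assms, of a] by auto
  have "(\<integral>\<^sup>+a. ennreal (if a \<in> {1..K} then p a else 0) \<partial>count_space UNIV) =
      (\<integral>\<^sup>+a. ennreal (p a) * indicator {1..K} a \<partial>count_space UNIV)"
    by (intro nn_integral_cong) auto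
  also have "\<dots> = (\<Sum>a\<in>{1..K}. ennreal (p a))"
    by (subst nn_integral_count_space_indicator[symmetric]) (auto simp: nn_integral_count_space_finite)
  also have "\<dots> = ennreal (\<Sum>a\<in>{1..K}. p a)"
    by (intro sum_ennreal less_imp_le Theta_probs(1)[OF assms])
  finally show "(\<integral>\<^sup>+a. ennreal (if a \<in> {1..K} then p a else 0) \<partial>count_space UNIV) = 1"
    using Theta_probs_sum[OF assms] by simp
qed

lemma set_labels_pmf:
  fixes z :: "nat \<Rightarrow> nat"
  assumes "(p, H) \<in> Theta K" "z \<in> set_pmf (Pi_pmf {1..n} undefined (\<lambda>_. label_pmf K p))"
  shows "z \<in> {1..n} \<rightarrow>\<^sub>E {1..K}"
proof -
  have "set_pmf (label_pmf K p) \<subseteq> {1..K}"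
    by (auto simp: set_pmf_eq pmf_label_pmf[OF assms(1)])
  moreover have "z \<in> PiE_dflt {1..n} undefined (\<lambda>_. set_pmf (label_pmf K p))"
    using set_Pi_pmf_subset'[of "{1..n}" undefined "\<lambda>_. label_pmf K p"] assms(2)
    by (auto simp: o_def)
  ultimately show ?thesis
    unfolding PiE_dflt_def by (intro PiE_I) auto
qed

lemma map_block_size_pmf:
  assumes \<theta>: "(p, H) \<in> Theta K" and a: "a \<in> {1..K}"
  shows "map_pmf (\<lambda>z. block_size n z a) (Pi_pmf {1..n} undefined (\<lambda>_. label_pmf K p)) =
    binomial_pmf n (p a)"
proof -
  have pa: "0 \<le> p a" "p a \<le> 1"
    using Theta_probs[OF \<theta> a] by auto
  have "pmf (map_pmf (\<lambda>x. x = a) (label_pmf K p)) True = p a"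
    using a by (simp add: pmf_map pmf_label_pmf[OF \<theta>] vimage_def measure_pmf_single)
  then have "map_pmf (\<lambda>x. x = a) (label_pmf K p) = bernoulli_pmf (p a)"
    by (intro pmf_eqI) (metis (full_types) pa pmf_bernoulli_True pmf_bernoulli_False pmf_False_conv_True)
  then have "binomial_pmf n (p a) = map_pmf (\<lambda>f. card {i \<in> {1..n}. f i})
      (Pi_pmf {1..n} (undefined = a) (\<lambda>_. map_pmf (\<lambda>x. x = a) (label_pmf K p)))"
    using pa binomial_pmf_altdef'[of "{1..n}" n "p a"] by simp
  also have "\<dots> = map_pmf (\<lambda>z. block_size n z a) (Pi_pmf {1..n} undefined (\<lambda>_. label_pmf K p))"
    by (subst Pi_pmf_map) (auto simp: map_pmf_comp o_def block_size_eq_card)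
  finally show ?thesis by simp
qed

text \<open>
  Block sizes are binomial with mean at least \<open>n * q\<close>, so Hoeffding's inequality applies to a
  deviation of \<open>n * q / 2\<close>.
\<close>

lemma prob_small_block_le:
  assumes \<theta>: "(p, H) \<in> Theta K" and n: "1 \<le> n" and q: "0 < q" "\<And>a. a \<in> {1..K} \<Longrightarrow> q \<le> p a"
  shows "measure_pmf.prob (Pi_pmf {1..n} undefined (\<lambda>_. label_pmf K p))
      {z. \<exists>a\<in>{1..K}. real (block_size n z a) \<le> real n * q / 2} \<le> real K * exp (- (q\<^sup>2 * real n / 2))"
proof -
  let ?M = "Pi_pmf {1..n} undefined (\<lambda>_. label_pmf K p)"
  have "measure_pmf.prob ?M {z. \<exists>a\<in>{1..K}. real (block_size n z a) \<le> real n * q / 2} =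
      measure_pmf.prob ?M (\<Union>a\<in>{1..K}. {z. real (block_size n z a) \<le> real n * q / 2})"
    by (intro arg_cong[where f = "measure_pmf.prob ?M"]) auto
  also have "\<dots> \<le> (\<Sum>a\<in>{1..K}. measure_pmf.prob ?M {z. real (block_size n z a) \<le> real n * q / 2})"
    by (intro measure_pmf.finite_measure_subadditive_finite) auto
  also have "\<dots> \<le> (\<Sum>a\<in>{1..K}. exp (- (q\<^sup>2 * real n / 2)))"
  proof (rule sum_mono)
    fix a assume a: "a \<in> {1..K}"
    interpret binomial_distribution n "p a"
      using Theta_probs[OF \<theta> a] by unfold_locales auto
    have "measure_pmf.prob ?M {z. real (block_size n z a) \<le> real n * q / 2} =
        measure_pmf.prob (map_pmf (\<lambda>z. block_size n z a) ?M) {x. real x \<le> real n * q / 2}"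
      by (simp add: vimage_def)
    also have "\<dots> \<le> measure_pmf.prob (binomial_pmf n (p a)) {x. real x \<le> real n * p a - real n * q / 2}"
      unfolding map_block_size_pmf[OF \<theta> a]
    proof (intro measure_pmf.finite_measure_mono subsetI CollectI)
      fix x :: nat
      assume "x \<in> {x. real x \<le> real n * q / 2}"
      moreover have "real n * q \<le> real n * p a"
        using q(2)[OF a] by (intro mult_left_mono) auto
      ultimately show "real x \<le> real n * p a - real n * q / 2" by simp
    qed simp
    also have "\<dots> \<le> exp (- 2 * (real n * q / 2)\<^sup>2 / real n)"
      using n q by (intro prob_le) auto
    also have "\<dots> = exp (- (q\<^sup>2 * real n / 2))"
      using n by (simp add: power2_eq_square field_simps)
    finally show "measure_pmf.prob ?M {z. real (block_size n z a) \<le> real n * q / 2} \<le>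
        exp (- (q\<^sup>2 * real n / 2))" .
  qed
  finally show ?thesis by simp
qed

text \<open>
  Conditioning on the first stage: outside an exceptional set \<open>B\<close> the second stage is controlled
  uniformly.
\<close>

lemma prob_bind_pmf_le:
  assumes "0 \<le> b" "\<And>x. x \<in> set_pmf M \<Longrightarrow> x \<notin> B \<Longrightarrow> measure_pmf.prob (f x) X \<le> b"
  shows "measure_pmf.prob (bind_pmf M f) X \<le> measure_pmf.prob M B + b"
proof -
  have "ennreal (measure_pmf.prob (bind_pmf M f) X) = (\<integral>\<^sup>+x. emeasure (f x) X \<partial>M)"
    by (simp flip: measure_pmf.emeasure_eq_measure)
  also have "\<dots> \<le> (\<integral>\<^sup>+x. indicator B x + ennreal b \<partial>M)"
  proof (rule nn_integral_mono_AE, unfold AE_measure_pmf_iff, intro ballI)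
    fix x assume x: "x \<in> set_pmf M"
    show "emeasure (f x) X \<le> indicator B x + ennreal b"
    proof (cases "x \<in> B")
      case True
      then have "emeasure (f x) X \<le> indicator B x"
        by (simp add: measure_pmf.emeasure_le_1)
      then show ?thesis by (rule order_trans) simp
    next
      case False
      with assms(2)[OF x] show ?thesis
        by (simp add: measure_pmf.emeasure_eq_measure ennreal_leI)
    qed
  qed
  also have "\<dots> = ennreal (measure_pmf.prob M B + b)"
    by (subst nn_integral_add) (auto simp: measure_pmf.emeasure_eq_measure assms(1))
  finally show ?thesis
    using assms(1) by (subst (asm) ennreal_le_iff) auto
qed

section \<open>Comparing the penalized likelihoods\<close>

text \<open>
  Combines \<open>prob_log_lik_exceeds_le\<close> for \<open>K'\<close> with \<open>log_lik_ge\<close> for \<open>K\<close>: off an event of small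
  probability \<open>L K' - L K < t - n * ln q\<close>, and the last hypothesis says that the penalties
  compensate for this. \<open>G\<close> collects the exceptional labelings, to which the separation \<open>D\<close> need not
  apply.
\<close>

lemma prob_penalized_lik_less_ge:
  assumes K: "1 \<le> K" "1 \<le> K'" and \<theta>: "(p, H) \<in> Theta K"
    and q: "0 < q" "\<And>a. a \<in> {1..K} \<Longrightarrow> q \<le> p a"
    and D: "\<And>z w Q. z \<in> {1..n} \<rightarrow>\<^sub>E {1..K} \<Longrightarrow> z \<notin> G \<Longrightarrow> w \<in> {1..n} \<rightarrow>\<^sub>E {1..K'} \<Longrightarrow>
      (\<And>a b. a \<in> {1..K'} \<Longrightarrow> b \<in> {1..K'} \<Longrightarrow> 0 \<le> Q a b \<and> Q a b \<le> 1 \<and> Q a b = Q b a) \<Longrightarrow>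
      D \<le> (\<Sum>(i, j)\<in>node_pairs n. (sqrt (H (z i) (z j)) - sqrt (Q (w i) (w j)))\<^sup>2)"
    and t: "t - real n * ln q \<le> (N K' - N K) * b"
  shows "1 - (measure_pmf.prob (Pi_pmf {1..n} undefined (\<lambda>_. label_pmf K p)) G +
      real K' ^ n * real ((n\<^sup>2 + 1) ^ K'\<^sup>2) * exp (- (t + D) / 2))
    \<le> measure_pmf.prob (sbm n K (p, H))
        {(Z, A). penalized_lik N b n A K' < penalized_lik N b n A K}"
    (is "1 - ?\<epsilon> \<le> measure_pmf.prob ?M ?good")
proof -
  let ?bad = "{(Z, A). ln (edge_lik n H Z A) + t \<le> log_lik n K' A}"
  have "measure_pmf.prob ?M ?bad \<le> ?\<epsilon>"
    unfolding sbm_def fst_conv snd_conv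
  proof (rule prob_bind_pmf_le)
    fix z
    assume z: "z \<in> set_pmf (Pi_pmf {1..n} undefined (\<lambda>_. label_pmf K p))" "z \<notin> G"
    note zK = set_labels_pmf[OF \<theta> z(1)]
    have "measure_pmf.prob (map_pmf (Pair z) (graph_pmf n H z)) ?bad =
        measure_pmf.prob (graph_pmf n H z) {A. ln (edge_lik n H z A) + t \<le> log_lik n K' A}"
      by (simp add: vimage_def)
    also have "\<dots> \<le> real K' ^ n * real ((n\<^sup>2 + 1) ^ K'\<^sup>2) * exp (- (t + D) / 2)"
      using K(2) Theta_matrix[OF \<theta> labels_of_pair[OF zK]] D[OF zK z(2)]
      by (intro prob_log_lik_exceeds_le) auto
    finally show "measure_pmf.prob (map_pmf (Pair z) (graph_pmf n H z)) ?bad \<le>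
        real K' ^ n * real ((n\<^sup>2 + 1) ^ K'\<^sup>2) * exp (- (t + D) / 2)" .
  qed auto
  moreover have "measure_pmf.prob ?M (UNIV - ?bad) = 1 - measure_pmf.prob ?M ?bad"
    using measure_pmf.prob_compl[of ?bad ?M] by simp
  moreover have "measure_pmf.prob ?M (UNIV - ?bad) \<le> measure_pmf.prob ?M ?good"
  proof (intro measure_pmf.finite_measure_mono_AE, unfold AE_measure_pmf_iff, safe)
    fix z A
    assume "(z, A) \<in> set_pmf ?M" and nb: "\<not> ln (edge_lik n H z A) + t \<le> log_lik n K' A"
    then have z: "z \<in> set_pmf (Pi_pmf {1..n} undefined (\<lambda>_. label_pmf K p))"
      and A: "A \<in> set_pmf (graph_pmf n H z)"
      by (auto simp: sbm_def)
    have "ln (edge_lik n H z A) + real n * ln q \<le> log_lik n K A"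
      using K(1) \<theta> set_graph_pmf_sym[OF A] set_labels_pmf[OF \<theta> z] q by (rule log_lik_ge)
    with nb t show "penalized_lik N b n A K' < penalized_lik N b n A K"
      by (simp add: penalized_lik_def log_lik_def[symmetric] left_diff_distrib)
  qed auto
  ultimately show ?thesis by linarith
qed

section \<open>Asymptotics\<close>

lemma polynomial_times_exp_tendsto_0:
  "(\<lambda>n. real ((n\<^sup>2 + 1) ^ k) * exp (- real n)) \<longlonglongrightarrow> 0"
proof (rule tendsto_sandwich[where f = "\<lambda>_. 0"])
  have "(\<lambda>n. exp 1 * (real (Suc n) ^ (2 * k) / exp (real (Suc n)))) \<longlonglongrightarrow> exp 1 * 0"
    by (intro tendsto_mult tendsto_const filterlim_compose[OF tendsto_power_div_exp_0]
        filterlim_compose[OF filterlim_real_sequentially filterlim_Suc])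
  then show "(\<lambda>n. exp 1 * (real (Suc n) ^ (2 * k) / exp (real (Suc n)))) \<longlonglongrightarrow> 0"
    by simp
  show "\<forall>\<^sub>F n in sequentially. real ((n\<^sup>2 + 1) ^ k) * exp (- real n) \<le>
      exp 1 * (real (Suc n) ^ (2 * k) / exp (real (Suc n)))"
  proof (rule always_eventually, rule allI)
    fix n
    (* Passing to \<open>n + 1\<close> turns the polynomial into a power, which the exponential is known to beat. *)
    have "real ((n\<^sup>2 + 1) ^ k) \<le> real ((Suc n ^ 2) ^ k)"
      by (intro of_nat_mono power_mono) (auto simp: power2_eq_square)
    also have "\<dots> = real (Suc n) ^ (2 * k)"
      by (simp add: power_mult)
    finally have "real ((n\<^sup>2 + 1) ^ k) * exp (- real n) \<le> real (Suc n) ^ (2 * k) * exp (- real n)"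
      by (rule mult_right_mono) simp
    also have "\<dots> = exp 1 * (real (Suc n) ^ (2 * k) / exp (real (Suc n)))"
      by (simp add: exp_add exp_minus field_simps)
    finally show "real ((n\<^sup>2 + 1) ^ k) * exp (- real n) \<le>
      exp 1 * (real (Suc n) ^ (2 * k) / exp (real (Suc n)))" .
  qed
qed auto

text \<open>
  An exponent of at least \<open>n * (ln l + 1)\<close> absorbs the number \<open>l ^ n\<close> of labelings and leaves
  \<open>exp (- n)\<close>, against which the polynomial number of estimates is negligible.
\<close>

lemma tendsto_1_of_union_bound:
  assumes q: "0 < q" and l: "1 \<le> l"
    and le: "\<forall>\<^sub>F n in sequentially. 1 - (real k * exp (- (q * real n)) +
      real l ^ n * real ((n\<^sup>2 + 1) ^ l\<^sup>2) * exp (- s n)) \<le> P n"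
    and s: "\<forall>\<^sub>F n in sequentially. real n * (ln (real l) + 1) \<le> s n"
    and P: "\<And>n. P n \<le> 1"
  shows "P \<longlonglongrightarrow> 1"
proof (rule tendsto_sandwich)
  let ?\<epsilon> = "\<lambda>n. real k * exp (- (q * real n)) + real ((n\<^sup>2 + 1) ^ l\<^sup>2) * exp (- real n)"
  have "filterlim (\<lambda>n. q * real n) at_top sequentially"
    by (rule filterlim_tendsto_pos_mult_at_top[OF tendsto_const q filterlim_real_sequentially])
  then have "(\<lambda>n. exp (- (q * real n))) \<longlonglongrightarrow> 0"
    by (intro filterlim_compose[OF exp_at_bot] filterlim_compose[OF filterlim_uminus_at_bot_at_top])
  then have "(\<lambda>n. 1 - ?\<epsilon> n) \<longlonglongrightarrow> 1 - (real k * 0 + 0)"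
    by (intro tendsto_intros polynomial_times_exp_tendsto_0)
  then show "(\<lambda>n. 1 - ?\<epsilon> n) \<longlonglongrightarrow> 1"
    by simp
  show "\<forall>\<^sub>F n in sequentially. 1 - ?\<epsilon> n \<le> P n"
    using le s
  proof eventually_elim
    case (elim n)
    have "real l ^ n * exp (- s n) = exp (real n * ln (real l)) * exp (- s n)"
      using l by (simp add: exp_of_nat_mult)
    also have "\<dots> = exp (real n * ln (real l) - s n)"
      by (simp add: exp_diff exp_minus field_simps)
    also have "\<dots> \<le> exp (- real n)"
      using elim(2) by (simp add: algebra_simps)
    finally have "real ((n\<^sup>2 + 1) ^ l\<^sup>2) * (real l ^ n * exp (- s n)) \<le>
        real ((n\<^sup>2 + 1) ^ l\<^sup>2) * exp (- real n)"
      by (rule mult_left_mono) simp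
    with elim(1) show ?case
      by (simp add: mult_ac)
  qed
qed (use P in auto)

lemma expected_degree_at_top:
  fixes \<rho> :: "nat \<Rightarrow> real"
  assumes pos: "\<And>n. n \<ge> 1 \<Longrightarrow> 0 < \<rho> n"
    and "\<rho> \<in> \<Omega>(\<lambda>_. 1) \<or>
      (\<rho> \<longlonglongrightarrow> 0 \<and> filterlim (\<lambda>n. real n * \<rho> n / ln (real n)) at_top sequentially)"
  shows "filterlim (\<lambda>n. real n * \<rho> n) at_top sequentially"
  using assms(2)
proof
  assume "\<rho> \<in> \<Omega>(\<lambda>_. 1)"
  then obtain c where c: "c > 0" and ev: "\<forall>\<^sub>F n in sequentially. c * norm (1 :: real) \<le> norm (\<rho> n)"
    by (elim landau_omega.bigE)
  have "filterlim (\<lambda>n. c * real n) at_top sequentially"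
    by (rule filterlim_tendsto_pos_mult_at_top[OF tendsto_const c filterlim_real_sequentially])
  then show ?thesis
  proof (rule filterlim_at_top_mono)
    show "\<forall>\<^sub>F n in sequentially. c * real n \<le> real n * \<rho> n"
      using ev eventually_ge_at_top[of 1]
    proof eventually_elim
      case (elim n)
      with pos[of n] show ?case by (simp add: mult.commute)
    qed
  qed
next
  assume *: "\<rho> \<longlonglongrightarrow> 0 \<and> filterlim (\<lambda>n. real n * \<rho> n / ln (real n)) at_top sequentially"
  show ?thesis
  proof (rule filterlim_at_top_mono[OF conjunct2[OF *]])
    show "\<forall>\<^sub>F n in sequentially. real n * \<rho> n / ln (real n) \<le> real n * \<rho> n"
      using eventually_ge_at_top[of 3]
    proof eventually_elim
      case (elim n)
      have "exp 1 \<le> real n"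
        using exp_le elim by linarith
      then have "1 \<le> ln (real n)"
        using elim by (subst ln_ge_iff) auto
      moreover have "0 \<le> real n * \<rho> n"
        using pos[of n] elim by auto
      ultimately have "real n * \<rho> n / ln (real n) \<le> real n * \<rho> n / 1"
        by (intro divide_left_mono) auto
      then show ?case by simp
    qed
  qed
qed

text \<open>
  Only finitely many squared differences occur, so the nonzero ones have a positive minimum. The
  square roots are those of \<open>S\<close>, which makes the gap independent of \<open>n\<close>.
\<close>

lemma uniform_column_gap:
  assumes cols: "no_identical_columns K (\<lambda>a b. \<rho> * S a b)"
    and S: "\<And>a b. a \<in> {1..K} \<Longrightarrow> b \<in> {1..K} \<Longrightarrow> 0 < S a b"
  shows "\<exists>\<kappa>>0. \<forall>a\<in>{1..K}. \<forall>b\<in>{1..K}. a \<noteq> b \<longrightarrow>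
    (\<exists>c\<in>{1..K}. \<kappa> \<le> (sqrt (S c a) - sqrt (S c b))\<^sup>2)"
proof -
  let ?X = "(\<lambda>(a, b, c). (sqrt (S c a) - sqrt (S c b))\<^sup>2) ` ({1..K} \<times> {1..K} \<times> {1..K}) - {0}"
  (* The value 1 is a default for \<open>K = 1\<close>, where there are no nonzero differences. *)
  define \<kappa> where "\<kappa> = Min (insert 1 ?X)"
  have "0 < x" if "x \<in> insert 1 ?X" for x
    using that by auto
  then have "0 < \<kappa>"
    unfolding \<kappa>_def by (subst Min_gr_iff) blast+
  moreover have "\<exists>c\<in>{1..K}. \<kappa> \<le> (sqrt (S c a) - sqrt (S c b))\<^sup>2"
    if ab: "a \<in> {1..K}" "b \<in> {1..K}" "a \<noteq> b" for a b
  proof -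
    obtain c where c: "c \<in> {1..K}" "\<rho> * S c a \<noteq> \<rho> * S c b"
      using cols ab unfolding no_identical_columns_def by blast
    then have "(sqrt (S c a) - sqrt (S c b))\<^sup>2 \<in> insert 1 ?X"
      using ab by (auto intro!: image_eqI[where x = "(a, b, c)"])
    then have "\<kappa> \<le> (sqrt (S c a) - sqrt (S c b))\<^sup>2"
      unfolding \<kappa>_def by (intro Min_le) auto
    with c show ?thesis by blast
  qed
  ultimately show ?thesis by blast
qed

text \<open>
  Applies \<open>merged_blocks_distance\<close> to \<open>sqrt H = sqrt \<rho> * sqrt S\<close>, whose squared gaps are \<open>\<rho>\<close> times
  those of \<open>sqrt S\<close>. A block with more than \<open>n * q / 2\<close> nodes is spread over at most \<open>K'\<close> blocks of
  \<open>w\<close>, hence \<open>m\<close> is about \<open>n * q / (2 * K')\<close>; the lower bound on \<open>n\<close> lets half of this survive the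
  rounding. The total over ordered pairs is twice the one over unordered pairs.
\<close>

lemma hellinger_separation:
  assumes K': "1 \<le> K'" "K' < K" and \<rho>: "0 < \<rho>" and \<kappa>: "0 \<le> \<kappa>"
    and H: "\<And>a b. H a b = \<rho> * S a b" and H_sym: "\<And>a b. a \<in> {1..K} \<Longrightarrow> b \<in> {1..K} \<Longrightarrow> H a b = H b a"
    and gap: "\<And>a b. a \<in> {1..K} \<Longrightarrow> b \<in> {1..K} \<Longrightarrow> a \<noteq> b \<Longrightarrow>
      \<exists>c\<in>{1..K}. \<kappa> \<le> (sqrt (S c a) - sqrt (S c b))\<^sup>2"
    and q: "0 < q" and n: "4 * real K' / q \<le> real n"
    and z: "z \<in> {1..n} \<rightarrow>\<^sub>E {1..K}" "\<And>a. a \<in> {1..K} \<Longrightarrow> real n * q / 2 < real (block_size n z a)"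
    and w: "w \<in> {1..n} \<rightarrow>\<^sub>E {1..K'}"
    and Q_sym: "\<And>a b. a \<in> {1..K'} \<Longrightarrow> b \<in> {1..K'} \<Longrightarrow> Q a b = Q b a"
  shows "(q / (4 * real K'))\<^sup>2 * \<kappa> / 4 * (real n ^ 2 * \<rho>) \<le>
    (\<Sum>(i, j)\<in>node_pairs n. (sqrt (H (z i) (z j)) - sqrt (Q (w i) (w j)))\<^sup>2)"
proof -
  define m where "m = nat \<lfloor>real n * q / (2 * real K')\<rfloor>"
  let ?g = "\<lambda>i j. (sqrt (H (z i) (z j)) - sqrt (Q (w i) (w j)))\<^sup>2"
  have K'_pos: "0 < real K'"
    using K' by simp
  have "1 \<le> real n * q / (4 * real K')"
    using n q K'_pos by (simp add: field_simps)
  then have m_ge: "real n * (q / (4 * real K')) \<le> real m"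
    unfolding m_def by (simp add: field_simps) linarith
  have m_le: "real m \<le> real n * q / (2 * real K')"
    unfolding m_def using q by (intro of_nat_floor) simp
  have big: "K' * m < block_size n z a" if a: "a \<in> {1..K}" for a
  proof -
    have "real (K' * m) \<le> real n * q / 2"
      using m_le K'_pos by (simp add: field_simps)
    also note z(2)[OF a]
    finally show ?thesis by (simp only: of_nat_less_iff)
  qed
  have gap': "\<exists>c\<in>{1..K}. \<rho> * \<kappa> \<le> (sqrt (H c a) - sqrt (H c b))\<^sup>2"
    if ab: "a \<in> {1..K}" "b \<in> {1..K}" "a \<noteq> b" for a b
  proof -
    obtain c where c: "c \<in> {1..K}" "\<kappa> \<le> (sqrt (S c a) - sqrt (S c b))\<^sup>2"
      using gap[OF ab] by blast
    have "(sqrt (H c a) - sqrt (H c b))\<^sup>2 = \<rho> * (sqrt (S c a) - sqrt (S c b))\<^sup>2"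
      using \<rho> by (simp add: H real_sqrt_mult power_mult_distrib flip: right_diff_distrib)
    with c \<rho> show ?thesis by (auto intro!: bexI[of _ c])
  qed
  have "(real n * (q / (4 * real K')))\<^sup>2 \<le> (real m)\<^sup>2"
    using m_ge q by (intro power_mono) auto
  then have "(real n * (q / (4 * real K')))\<^sup>2 * (\<rho> * \<kappa> / 2) \<le> (real m)\<^sup>2 * (\<rho> * \<kappa> / 2)"
    using \<rho> \<kappa> by (intro mult_right_mono) auto
  also have "\<dots> = real m * real m * (\<rho> * \<kappa>) / 2"
    by (simp add: power2_eq_square)
  also have "\<dots> \<le> (\<Sum>i\<in>{1..n}. \<Sum>j\<in>{1..n} - {i}. ?g i j)"
    using merged_blocks_distance[of K' K "\<rho> * \<kappa>" w n m z "\<lambda>a b. sqrt (H a b)" "\<lambda>a b. sqrt (Q a b)"]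
      K' \<rho> \<kappa> w big gap' by simp
  also have "\<dots> = (\<Sum>(i, j)\<in>node_pairs n. ?g i j) + (\<Sum>(i, j)\<in>node_pairs n. ?g i j)"
  proof (rule sum.off_diagonal)
    fix i j assume "i \<in> {1..n}" "j \<in> {1..n}"
    then show "?g i j = ?g j i"
      using H_sym[of "z i" "z j"] Q_sym[of "w i" "w j"] PiE_mem[OF z(1)] PiE_mem[OF w] by simp
  qed
  finally show ?thesis
    by (simp add: power_mult_distrib power_divide mult_ac)
qed

theorem corollary2p8:
  fixes K :: nat and p :: "nat \<Rightarrow> real" and S :: "nat \<Rightarrow> nat \<Rightarrow> real"
    and \<rho> B N :: "nat \<Rightarrow> real" and H :: "nat \<Rightarrow> nat \<Rightarrow> nat \<Rightarrow> real"
  assumes "K \<ge> 1"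
    and "\<And>a b. a \<in> {1..K} \<Longrightarrow> b \<in> {1..K} \<Longrightarrow> S a b > 0 \<and> S a b = S b a"
    and "\<And>n a b. H n a b = \<rho> n * S a b"
    and "\<And>n. n \<ge> 1 \<Longrightarrow> (p, H n) \<in> Theta K"
    and "\<And>n. n \<ge> 1 \<Longrightarrow> no_identical_columns K (H n)"
    and "\<rho> \<in> \<Omega>(\<lambda>_. 1) \<or>
         (\<rho> \<longlonglongrightarrow> 0 \<and> filterlim (\<lambda>n. real n * \<rho> n / ln (real n)) at_top sequentially)"
    and "strict_mono_on {1..} N"
    and "\<And>n. n \<ge> 1 \<Longrightarrow> B n > 0"
  shows "(\<forall>K'. 1 \<le> K' \<and> K' < K \<and> B \<in> o(\<lambda>n. real n ^ 2 * \<rho> n) \<longrightarrow>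
            (\<lambda>n. measure_pmf.prob (sbm n K (p, H n))
               {(Z, A). penalized_lik N (B n) n A K' < penalized_lik N (B n) n A K})
            \<longlonglongrightarrow> 1) \<and>
         (\<forall>K'. K' > K \<and>
            filterlim (\<lambda>n. B n * real n powr (-3/2) * \<rho> n powr (-1/2)) at_top sequentially \<longrightarrow>
            (\<lambda>n. measure_pmf.prob (sbm n K (p, H n))
               {(Z, A). penalized_lik N (B n) n A K' < penalized_lik N (B n) n A K})
            \<longlonglongrightarrow> 1)"
proof -
  note S = assms(2) and H = assms(3) and \<theta> = assms(4) and N = assms(7)
  have one: "1 \<in> {1..K}"
    using assms(1) by simp
  have \<rho>_pos: "0 < \<rho> n" if "n \<ge> 1" for n
    using Theta_matrix[OF \<theta>[OF that] one one] S[OF one one] unfolding H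
    by (simp add: zero_less_mult_iff)
  define q where "q = Min (p ` {1..K})"
  have q_le: "q \<le> p a" if "a \<in> {1..K}" for a
    using that unfolding q_def by (intro Min_le) auto
  have "q \<in> p ` {1..K}"
    unfolding q_def using assms(1) by (intro Min_in) auto
  then have q_pos: "0 < q"
    using Theta_probs(1)[OF \<theta>[of 1]] by auto
  have degree: "filterlim (\<lambda>n. real n * \<rho> n) at_top sequentially"
    using \<rho>_pos assms(6) by (rule expected_degree_at_top)
  have ev_degree: "\<forall>\<^sub>F n in sequentially. C \<le> real n * \<rho> n" for C
    using degree unfolding filterlim_at_top by blast
  have "(\<lambda>n. measure_pmf.prob (sbm n K (p, H n))
      {(Z, A). penalized_lik N (B n) n A K' < penalized_lik N (B n) n A K}) \<longlonglongrightarrow> 1"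
    if K': "1 \<le> K'" "K' < K" and B: "B \<in> o(\<lambda>n. real n ^ 2 * \<rho> n)" for K'
  proof -
    have "no_identical_columns K (\<lambda>a b. \<rho> 1 * S a b)"
      using assms(5)[of 1] by (simp add: H[symmetric])
    then obtain \<kappa> where \<kappa>: "\<kappa> > 0" and gap: "\<And>a b. a \<in> {1..K} \<Longrightarrow> b \<in> {1..K} \<Longrightarrow> a \<noteq> b \<Longrightarrow>
        \<exists>c\<in>{1..K}. \<kappa> \<le> (sqrt (S c a) - sqrt (S c b))\<^sup>2"
      using uniform_column_gap[of K "\<rho> 1" S] S by blast
    define c where "c = (q / (4 * real K'))\<^sup>2 * \<kappa> / 4"
    have c: "c > 0"
      using q_pos K' \<kappa> unfolding c_def by simp
    define D where "D n = c * (real n ^ 2 * \<rho> n)" for n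
    define G where "G n = {z. \<exists>a\<in>{1..K}. real (block_size n z a) \<le> real n * q / 2}" for n
    have N_gap: "N K' < N K"
      using N K' by (auto simp: strict_mono_on_def)
    show ?thesis
    proof (rule tendsto_1_of_union_bound)
      show "0 < q\<^sup>2 / 2" "1 \<le> K'"
        using q_pos K' by auto
      show "\<forall>\<^sub>F n in sequentially. real n * (ln (real K') + 1) \<le> D n / 4"
        using ev_degree[of "4 * (ln (real K') + 1) / c"]
      proof eventually_elim
        case (elim n)
        then have "ln (real K') + 1 \<le> c * (real n * \<rho> n) / 4"
          using c by (simp add: field_simps)
        then have "real n * (ln (real K') + 1) \<le> real n * (c * (real n * \<rho> n) / 4)"
          by (rule mult_left_mono) simp
        then show ?case by (simp add: D_def power2_eq_square mult_ac)
      qed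
      have ev_B: "\<forall>\<^sub>F n in sequentially. norm (B n) \<le> c / (4 * (N K - N K')) * norm (real n ^ 2 * \<rho> n)"
        using B c N_gap by (intro landau_o.smallD) auto
      show "\<forall>\<^sub>F n in sequentially. 1 - (real K * exp (- (q\<^sup>2 / 2 * real n)) +
          real K' ^ n * real ((n\<^sup>2 + 1) ^ K'\<^sup>2) * exp (- (D n / 4))) \<le>
        measure_pmf.prob (sbm n K (p, H n))
          {(Z, A). penalized_lik N (B n) n A K' < penalized_lik N (B n) n A K}"
        using ev_B ev_degree[of "- 4 * ln q / c"] eventually_ge_at_top[of 1]
          eventually_ge_at_top[of "nat \<lceil>4 * real K' / q\<rceil>"]
      proof eventually_elim
        case (elim n)
        note n = elim(3)
        have n_large: "4 * real K' / q \<le> real n"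
          using elim(4) by linarith
        have "(N K - N K') * B n \<le> c / 4 * (real n ^ 2 * \<rho> n)"
          using elim(1) N_gap assms(8)[OF n] \<rho>_pos[OF n] by (simp add: field_simps)
        moreover have "- real n * ln q \<le> c / 4 * (real n ^ 2 * \<rho> n)"
        proof -
          have "- ln q \<le> c / 4 * (real n * \<rho> n)"
            using elim(2) c by (simp add: field_simps)
          then have "real n * (- ln q) \<le> real n * (c / 4 * (real n * \<rho> n))"
            by (rule mult_left_mono) simp
          then show ?thesis by (simp add: power2_eq_square mult_ac)
        qed
        ultimately have t: "- D n / 2 - real n * ln q \<le> (N K' - N K) * B n"
          unfolding D_def by (simp add: left_diff_distrib)
        (* With \<open>t = - D / 2\<close> half of the separation pays for the union bound and half is gained. *)
        have "1 - (measure_pmf.prob (Pi_pmf {1..n} undefined (\<lambda>_. label_pmf K p)) (G n) +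
            real K' ^ n * real ((n\<^sup>2 + 1) ^ K'\<^sup>2) * exp (- (- D n / 2 + D n) / 2)) \<le>
          measure_pmf.prob (sbm n K (p, H n))
            {(Z, A). penalized_lik N (B n) n A K' < penalized_lik N (B n) n A K}"
        proof (rule prob_penalized_lik_less_ge[OF assms(1) K'(1) \<theta>[OF n] q_pos q_le _ t])
          fix z w Q
          assume "z \<in> {1..n} \<rightarrow>\<^sub>E {1..K}" "z \<notin> G n" "w \<in> {1..n} \<rightarrow>\<^sub>E {1..K'}"
            and "\<And>a b. a \<in> {1..K'} \<Longrightarrow> b \<in> {1..K'} \<Longrightarrow> 0 \<le> Q a b \<and> Q a b \<le> (1::real) \<and> Q a b = Q b a"
          then show "D n \<le> (\<Sum>(i, j)\<in>node_pairs n.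
              (sqrt (H n (z i) (z j)) - sqrt (Q (w i) (w j)))\<^sup>2)"
            unfolding D_def c_def G_def
            by (intro hellinger_separation[where S = S and K = K])
               (use K' \<rho>_pos[OF n] \<kappa> gap q_pos n_large Theta_matrix[OF \<theta>[OF n]]
                in \<open>auto simp: H not_le\<close>)
        qed
        moreover have "measure_pmf.prob (Pi_pmf {1..n} undefined (\<lambda>_. label_pmf K p)) (G n) \<le>
            real K * exp (- (q\<^sup>2 / 2 * real n))"
          unfolding G_def using prob_small_block_le[OF \<theta>[OF n] n q_pos q_le] by simp
        ultimately show ?case by simp
      qed
    qed simp
  qed
  moreover have "(\<lambda>n. measure_pmf.prob (sbm n K (p, H n))
      {(Z, A). penalized_lik N (B n) n A K' < penalized_lik N (B n) n A K}) \<longlonglongrightarrow> 1"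
    if K': "K < K'"
      and B: "filterlim (\<lambda>n. B n * real n powr (-3/2) * \<rho> n powr (-1/2)) at_top sequentially" for K'
  proof -
    have K'_ge: "1 \<le> K'"
      using K' by simp
    define C where "C = 2 * (ln (real K') + 1) - ln q"
    have N_gap: "N K < N K'"
      using N K' assms(1) by (auto simp: strict_mono_on_def)
    have ev_B: "\<forall>\<^sub>F n in sequentially. \<bar>C\<bar> / (N K' - N K) \<le> B n * real n powr (-3/2) * \<rho> n powr (-1/2)"
      using B unfolding filterlim_at_top by blast
    show ?thesis
    proof (rule tendsto_1_of_union_bound)
      show "(0::real) < 1" "1 \<le> K'"
        using K'_ge by auto
      show "\<forall>\<^sub>F n in sequentially. real n * (ln (real K') + 1) \<le> real n * (ln (real K') + 1)"
        by simp
      show "\<forall>\<^sub>F n in sequentially. 1 - (real 0 * exp (- (1 * real n)) +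
          real K' ^ n * real ((n\<^sup>2 + 1) ^ K'\<^sup>2) * exp (- (real n * (ln (real K') + 1)))) \<le>
        measure_pmf.prob (sbm n K (p, H n))
          {(Z, A). penalized_lik N (B n) n A K' < penalized_lik N (B n) n A K}"
        using ev_B ev_degree[of 1] eventually_ge_at_top[of 1]
      proof eventually_elim
        case (elim n)
        note n = elim(3)
        (* Half of this \<open>t\<close> is \<open>n * ln K'\<close>, which pays for the union bound over labelings, plus \<open>n\<close>. *)
        define t where "t = 2 * (real n * (ln (real K') + 1))"
        have "real n * 1 \<le> real n * sqrt (real n * \<rho> n)"
          using elim(2) by (intro mult_left_mono) auto
        also have "\<dots> = real n powr (3/2) * \<rho> n powr (1/2)"
          using n \<rho>_pos[OF n] by (simp add: powr_half_sqrt[symmetric] powr_mult powr_mult_base)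
        finally have scale: "real n \<le> real n powr (3/2) * \<rho> n powr (1/2)"
          by simp
        have "B n = B n * real n powr (-3/2) * \<rho> n powr (-1/2) * (real n powr (3/2) * \<rho> n powr (1/2))"
          using n \<rho>_pos[OF n] by (simp add: powr_minus field_simps)
        also have "\<dots> \<ge> \<bar>C\<bar> / (N K' - N K) * real n"
          using elim(1) scale N_gap assms(8)[OF n] by (intro mult_mono) auto
        finally have "\<bar>C\<bar> * real n \<le> (N K' - N K) * B n"
          using N_gap by (simp add: field_simps)
        moreover have "C * real n \<le> \<bar>C\<bar> * real n"
          by (intro mult_right_mono) auto
        ultimately have t: "t - real n * ln q \<le> (N K' - N K) * B n"
          unfolding t_def C_def by (simp add: algebra_simps)
        have "1 - (measure_pmf.prob (Pi_pmf {1..n} undefined (\<lambda>_. label_pmf K p)) {} +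
            real K' ^ n * real ((n\<^sup>2 + 1) ^ K'\<^sup>2) * exp (- (t + 0) / 2)) \<le>
          measure_pmf.prob (sbm n K (p, H n))
            {(Z, A). penalized_lik N (B n) n A K' < penalized_lik N (B n) n A K}"
          by (rule prob_penalized_lik_less_ge[OF assms(1) K'_ge \<theta>[OF n] q_pos q_le _ t])
             (auto intro!: sum_nonneg)
        then show ?case
          by (simp add: t_def)
      qed
    qed simp
  qed
  ultimately show ?thesis by blast
qed

end
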